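(* Let $(G,c)$ be an infinite resistance network. Up to unitary isomorphism, the von Neumann embedding of $(G,R^F)$ into a Hilbert space is $V:G^0\to\mathcal{H}_{\mathcal{E}}$ given by $x\mapsto v_x$, and the von Neumann embedding of $(G,R^W)$ into a Hilbert space is $F:G^0\to\operatorname{Fin}$ given by $x\mapsto f_x$. That is: (1) $R^F(x,y)=\|v_x-v_y\|_{\mathcal{E}}^2$ for all vertices $x,y$, and if $\mathcal{K}$ is a real Hilbert space and $k:G^0\to\mathcal{K}$, $x\mapsto k_x$, satisfies $\|k_x-k_y\|_{\mathcal{K}}^2=R^F(x,y)$ for all $x,y$, with the linear span of $\{k_x-k_o\}_{x\in G^0}$ dense in $\mathcal{K}$, then there is a unitary isomorphism $U:\mathcal{K}\to\mathcal{H}_{\mathcal{E}}$ with $U(k_x-k_o)=v_x$ for all $x$. (2) $R^W(x,y)=\|f_x-f_y\|_{\mathcal{E}}^2$ for all vertices $x,y$, and if $\mathcal{K}$ is a real Hilbert space and $k:G^0\to\mathcal{K}$, $x\mapsto k_x$, satisfies $\|k_x-k_y\|_{\mathcal{K}}^2=R^W(x,y)$ for all $x,y$, with the linear span of $\{k_x-k_o\}_{x\in G^0}$ dense in $\mathcal{K}$, then there is a unitary isomorphism $U:\mathcal{K}\to\operatorname{Fin}$ with $U(k_x-k_o)=f_x$ for all $x$.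
   Context: A resistance network $(G,c)$ is a connected graph with vertex set $G^0$ and a conductance function $c:G^0\times G^0\to[0,\infty)$ with $c_{xy}=c_{yx}$, $c_{xx}=0$, where $x\sim y$ iff $c_{xy}>0$, and $c(x):=\sum_{y\sim x}c_{xy}<\infty$ for every vertex $x$ (vertices of infinite degree are allowed). Connected means that any two vertices are joined by a finite path of edges. All functions are real-valued. The Laplacian is $(\Delta v)(x)=\sum_{y\sim x}c_{xy}(v(x)-v(y))$. The energy form is $\mathcal{E}(u,v)=\frac12\sum_{x,y\in G^0}c_{xy}(u(x)-u(y))(v(x)-v(y))$, $\mathcal{E}(u)=\mathcal{E}(u,u)$, and $\operatorname{dom}\mathcal{E}=\{u:G^0\to\mathbb{R} : \mathcal{E}(u)<\infty\}$. The energy space $\mathcal{H}_{\mathcal{E}}=\operatorname{dom}\mathcal{E}/\{\text{constants}\}$ is a real Hilbert space with inner product $\langle u,v\rangle_{\mathcal{E}}=\mathcal{E}(u,v)$ and norm $\|u\|_{\mathcal{E}}=\mathcal{E}(u)^{1/2}$. Fix a reference vertex $o$; $v_x\in\mathcal{H}_{\mathcal{E}}$ is the unique element with $\langle v_x,u\rangle_{\mathcal{E}}=u(x)-u(o)$ for all $u\in\mathcal{H}_{\mathcal{E}}$. $\operatorname{Fin}$ is the closure in $\mathcal{H}_{\mathcal{E}}$ of the linear span of the indicator functions $\delta_x$ of single vertices, $P_{\operatorname{Fin}}$ is the orthogonal projection onto $\operatorname{Fin}$, and $f_x:=P_{\operatorname{Fin}}v_x$. On a finite network $H$, $R_H(x,y)=v(x)-v(y)$,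 where $v$ is any solution of $\Delta v=\delta_x-\delta_y$ on $H$. An exhaustion $\{G_k\}$ of $G$ is an increasing sequence of finite connected full subgraphs with union $G$ (full: containing all edges of $G$ between its vertices, with the same conductances). $G_k^F$ is this full subnetwork. $G_k^W$ is the network with vertex set $G_k^0\cup\{\infty_k\}$, all edges of $G_k$ with the same conductances, and for each $x\in G_k^0$ with a neighbour outside $G_k$ an edge from $x$ to $\infty_k$ of conductance $\sum_{y\sim x,\,y\notin G_k}c_{xy}$. Then $R^F(x,y):=\lim_kR_{G_k^F}(x,y)$ and $R^W(x,y):=\lim_kR_{G_k^W}(x,y)$, for any exhaustion with $x,y\in G_k$ for all $k$ (limits independent of the exhaustion). A von Neumann embedding of $(G,R)$, for $R=R^F$ or $R^W$, is an embedding $w:G^0\to\mathcal{H}$ into a Hilbert space with $R(x,y)^{1/2}=\|w_x-w_y\|_{\mathcal{H}}$ (i.e. the isometry is with respect to the metric $R^{1/2}$). *)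

theory Defs
  imports "HOL-Analysis.Analysis"
begin

text \<open>
  A network is a vertex set \<open>V\<close> together with a conductance function \<open>c\<close>; only the values of
  \<open>c\<close> on \<open>V \<times> V\<close> matter.  Functions on \<open>V\<close> are represented by total functions, whose values
  outside \<open>V\<close> are ignored throughout.
\<close>

definition connected_net :: "'v set \<Rightarrow> ('v \<Rightarrow> 'v \<Rightarrow> real) \<Rightarrow> bool" where
  "connected_net V c \<longleftrightarrow>
     (\<forall>x\<in>V. \<forall>y\<in>V. (\<lambda>a b. a \<in> V \<and> b \<in> V \<and> 0 < c a b)\<^sup>*\<^sup>* x y)"

definition resistance_network :: "'v set \<Rightarrow> ('v \<Rightarrow> 'v \<Rightarrow> real) \<Rightarrow> bool" where
  "resistance_network V c \<longleftrightarrow>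
     (\<forall>x\<in>V. \<forall>y\<in>V. 0 \<le> c x y \<and> c x y = c y x) \<and>
     (\<forall>x\<in>V. c x x = 0) \<and>
     (\<forall>x\<in>V. c x summable_on {y\<in>V. 0 < c x y}) \<and>
     connected_net V c"

definition laplacian :: "'v set \<Rightarrow> ('v \<Rightarrow> 'v \<Rightarrow> real) \<Rightarrow> ('v \<Rightarrow> real) \<Rightarrow> 'v \<Rightarrow> real" where
  "laplacian V c v x = (\<Sum>\<^sub>\<infinity>y\<in>{y\<in>V. 0 < c x y}. c x y * (v x - v y))"


subsection \<open>The energy space\<close>

definition energy ::
  "'v set \<Rightarrow> ('v \<Rightarrow> 'v \<Rightarrow> real) \<Rightarrow> ('v \<Rightarrow> real) \<Rightarrow> ('v \<Rightarrow> real) \<Rightarrow> real" where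
  "energy V c u w = (\<Sum>\<^sub>\<infinity>(x, y)\<in>V \<times> V. c x y * (u x - u y) * (w x - w y)) / 2"

definition dom_energy :: "'v set \<Rightarrow> ('v \<Rightarrow> 'v \<Rightarrow> real) \<Rightarrow> ('v \<Rightarrow> real) set" where
  "dom_energy V c = {u. (\<lambda>(x, y). c x y * (u x - u y)\<^sup>2) summable_on V \<times> V}"

definition const_rel :: "'v set \<Rightarrow> ('v \<Rightarrow> 'v \<Rightarrow> real) \<Rightarrow> (('v \<Rightarrow> real) \<times> ('v \<Rightarrow> real)) set" where
  "const_rel V c = {(u, w). u \<in> dom_energy V c \<and> w \<in> dom_energy V c \<and>
                            (\<exists>a. \<forall>x\<in>V. u x - w x = a)}"

definition energy_space :: "'v set \<Rightarrow> ('v \<Rightarrow> 'v \<Rightarrow> real) \<Rightarrow> ('v \<Rightarrow> real) set set" where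
  "energy_space V c = dom_energy V c // const_rel V c"

definition eclass :: "'v set \<Rightarrow> ('v \<Rightarrow> 'v \<Rightarrow> real) \<Rightarrow> ('v \<Rightarrow> real) \<Rightarrow> ('v \<Rightarrow> real) set" where
  "eclass V c u = const_rel V c `` {u}"

text \<open>
  The Hilbert space structure of the quotient is defined through a chosen representative of each
  class; none of the operations below depends on the choice.
\<close>

definition erep :: "('v \<Rightarrow> real) set \<Rightarrow> 'v \<Rightarrow> real" where
  "erep A = (SOME u. u \<in> A)"

definition eadd ::
  "'v set \<Rightarrow> ('v \<Rightarrow> 'v \<Rightarrow> real) \<Rightarrow> ('v \<Rightarrow> real) set \<Rightarrow> ('v \<Rightarrow> real) set \<Rightarrow> ('v \<Rightarrow> real) set" where
  "eadd V c A B = eclass V c (\<lambda>x. erep A x + erep B x)"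

definition escale ::
  "'v set \<Rightarrow> ('v \<Rightarrow> 'v \<Rightarrow> real) \<Rightarrow> real \<Rightarrow> ('v \<Rightarrow> real) set \<Rightarrow> ('v \<Rightarrow> real) set" where
  "escale V c r A = eclass V c (\<lambda>x. r * erep A x)"

definition ediff ::
  "'v set \<Rightarrow> ('v \<Rightarrow> 'v \<Rightarrow> real) \<Rightarrow> ('v \<Rightarrow> real) set \<Rightarrow> ('v \<Rightarrow> real) set \<Rightarrow> ('v \<Rightarrow> real) set" where
  "ediff V c A B = eclass V c (\<lambda>x. erep A x - erep B x)"

definition einner ::
  "'v set \<Rightarrow> ('v \<Rightarrow> 'v \<Rightarrow> real) \<Rightarrow> ('v \<Rightarrow> real) set \<Rightarrow> ('v \<Rightarrow> real) set \<Rightarrow> real" where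
  "einner V c A B = energy V c (erep A) (erep B)"

definition enorm :: "'v set \<Rightarrow> ('v \<Rightarrow> 'v \<Rightarrow> real) \<Rightarrow> ('v \<Rightarrow> real) set \<Rightarrow> real" where
  "enorm V c A = sqrt (einner V c A A)"

text \<open>
  \<open>dipole V c x0 x\<close> is the class \<open>v\<^sub>x\<close> representing \<open>u \<mapsto> u x - u x0\<close>, and \<open>fin_dipole V c x0 x\<close> below
  is its projection \<open>f\<^sub>x\<close> to \<open>Fin\<close>.
\<close>

definition dipole :: "'v set \<Rightarrow> ('v \<Rightarrow> 'v \<Rightarrow> real) \<Rightarrow> 'v \<Rightarrow> 'v \<Rightarrow> ('v \<Rightarrow> real) set" where
  "dipole V c x0 x = (THE A. A \<in> energy_space V c \<and>
     (\<forall>B\<in>energy_space V c. einner V c A B = erep B x - erep B x0))"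

definition delta_span :: "'v set \<Rightarrow> ('v \<Rightarrow> 'v \<Rightarrow> real) \<Rightarrow> ('v \<Rightarrow> real) set set" where
  "delta_span V c =
     {eclass V c (\<lambda>z. \<Sum>x\<in>S. a x * indicator {x} z) | S a. finite S \<and> S \<subseteq> V}"

definition Fin :: "'v set \<Rightarrow> ('v \<Rightarrow> 'v \<Rightarrow> real) \<Rightarrow> ('v \<Rightarrow> real) set set" where
  "Fin V c =
     Metric_space.mtopology (energy_space V c) (\<lambda>A B. enorm V c (ediff V c A B))
       closure_of delta_span V c"

definition proj_Fin ::
  "'v set \<Rightarrow> ('v \<Rightarrow> 'v \<Rightarrow> real) \<Rightarrow> ('v \<Rightarrow> real) set \<Rightarrow> ('v \<Rightarrow> real) set" where
  "proj_Fin V c A = (THE P. P \<in> Fin V c \<and> (\<forall>B\<in>Fin V c. einner V c (ediff V c A P) B = 0))"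

definition fin_dipole :: "'v set \<Rightarrow> ('v \<Rightarrow> 'v \<Rightarrow> real) \<Rightarrow> 'v \<Rightarrow> 'v \<Rightarrow> ('v \<Rightarrow> real) set" where
  "fin_dipole V c x0 x = proj_Fin V c (dipole V c x0 x)"

definition unitary_iso ::
  "'v set \<Rightarrow> ('v \<Rightarrow> 'v \<Rightarrow> real) \<Rightarrow> ('v \<Rightarrow> real) set set \<Rightarrow>
   ('k::real_inner \<Rightarrow> ('v \<Rightarrow> real) set) \<Rightarrow> bool" where
  "unitary_iso V c M U \<longleftrightarrow>
     bij_betw U UNIV M \<and>
     (\<forall>a b. U (a + b) = eadd V c (U a) (U b)) \<and>
     (\<forall>r a. U (r *\<^sub>R a) = escale V c r (U a)) \<and>
     (\<forall>a b. einner V c (U a) (U b) = inner a b)"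


subsection \<open>Free and wired effective resistance\<close>

definition fin_resistance :: "'v set \<Rightarrow> ('v \<Rightarrow> 'v \<Rightarrow> real) \<Rightarrow> 'v \<Rightarrow> 'v \<Rightarrow> real" where
  "fin_resistance H c x y = (THE r. \<exists>v.
     (\<forall>z\<in>H. laplacian H c v z = indicator {x} z - indicator {y} z) \<and> r = v x - v y)"

text \<open>Full subgraphs are identified with their vertex sets.\<close>

definition exhaustion :: "'v set \<Rightarrow> ('v \<Rightarrow> 'v \<Rightarrow> real) \<Rightarrow> (nat \<Rightarrow> 'v set) \<Rightarrow> bool" where
  "exhaustion V c G \<longleftrightarrow>
     (\<forall>k. finite (G k) \<and> connected_net (G k) c) \<and> incseq G \<and> (\<Union>k. G k) = V"

text \<open>
  The wired network of \<open>S \<subseteq> V\<close> has vertex set \<open>insert None (Some ` S)\<close>, where \<open>None\<close> is the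
  vertex at infinity.
\<close>

definition wired_vertices :: "'v set \<Rightarrow> 'v option set" where
  "wired_vertices S = insert None (Some ` S)"

definition boundary_cond :: "'v set \<Rightarrow> ('v \<Rightarrow> 'v \<Rightarrow> real) \<Rightarrow> 'v set \<Rightarrow> 'v \<Rightarrow> real" where
  "boundary_cond V c S x = (\<Sum>\<^sub>\<infinity>y\<in>{y\<in>V - S. 0 < c x y}. c x y)"

fun wired_cond ::
  "'v set \<Rightarrow> ('v \<Rightarrow> 'v \<Rightarrow> real) \<Rightarrow> 'v set \<Rightarrow> 'v option \<Rightarrow> 'v option \<Rightarrow> real" where
  "wired_cond V c S (Some x) (Some y) = c x y"
| "wired_cond V c S (Some x) None = boundary_cond V c S x"
| "wired_cond V c S None (Some y) = boundary_cond V c S y"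
| "wired_cond V c S None None = 0"

text \<open>
  The limits exist and do not depend on the exhaustion, so the descriptions below single out
  the common value.
\<close>

definition free_resistance :: "'v set \<Rightarrow> ('v \<Rightarrow> 'v \<Rightarrow> real) \<Rightarrow> 'v \<Rightarrow> 'v \<Rightarrow> real" where
  "free_resistance V c x y = (THE r. \<forall>G. exhaustion V c G \<and> (\<forall>k. x \<in> G k \<and> y \<in> G k) \<longrightarrow>
     (\<lambda>k. fin_resistance (G k) c x y) \<longlonglongrightarrow> r)"

definition wired_resistance :: "'v set \<Rightarrow> ('v \<Rightarrow> 'v \<Rightarrow> real) \<Rightarrow> 'v \<Rightarrow> 'v \<Rightarrow> real" where
  "wired_resistance V c x y = (THE r. \<forall>G. exhaustion V c G \<and> (\<forall>k. x \<in> G k \<and> y \<in> G k) \<longrightarrow>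
     (\<lambda>k. fin_resistance (wired_vertices (G k)) (wired_cond V c (G k)) (Some x) (Some y))
       \<longlonglongrightarrow> r)"

end

theory Submission
  imports Defs
begin

text \<open>
  A function \<open>u\<close> of finite energy is determined up to a constant by its weighted gradient
  \<open>(x, y) \<mapsto> sqrt (c x y / 2) * (u x - u y)\<close>, and the energy form of two functions is the inner
  product of their gradients in the space of square summable families on \<open>V \<times> V\<close>.  So the energy
  space is, isometrically, the set \<open>grads V c\<close> of all gradients.  This set is closed, because along
  a norm-convergent sequence of gradients the potential differences converge on every edge and hence,
  along paths, between any two vertices.  All questions of completeness and projection therefore
  take place inside one concrete Hilbert space.
  
  The drop \<open>u x - u x0\<close> is a finite combination of coordinates of the gradient of \<open>u\<close>, summed along
  a path from \<open>x0\<close> to \<open>x\<close>; projecting the corresponding vector to the gradients gives the dipole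
  \<open>v\<^sub>x\<close>.  On a finite network the same construction gives
  the solution of \<open>\<Delta>v = \<delta>\<^sub>x - \<delta>\<^sub>y\<close>, since the Gauss--Green formula says that pairing a gradient with
  that of \<open>\<delta>\<^sub>z\<close> evaluates the Laplacian at \<open>z\<close>.  In particular the resistance of a finite network is
  the squared norm of the gradient of such a solution.
  
  Free resistance (\<open>free_limit\<close>): let \<open>g\<^sub>k\<close> be the gradient of the solution on \<open>G\<^sub>k\<close>, extended by
  zero.  Pairing it with the gradient of any function \<open>u\<close> of finite energy, defined on \<open>G\<^sub>k\<close> or on a
  larger subnetwork, gives \<open>u x - u y\<close>.  Hence \<open>\<langle>g\<^sub>k, g\<^sub>l\<rangle> = \<parallel>g\<^sub>l\<parallel>\<^sup>2\<close> for \<open>k \<le> l\<close>, so the \<open>g\<^sub>k\<close> form a Cauchy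
  sequence; the limit is again a gradient and has the same pairings as \<open>v\<^sub>x - v\<^sub>y\<close>, so the two agree.
  
  Wired resistance (\<open>wired_limit\<close>): the solution on the wired network, grounded at infinity and
  extended by zero, is a finitely supported function on \<open>V\<close> whose gradient is the orthogonal
  projection of \<open>v\<^sub>x - v\<^sub>y\<close> onto the span of the \<open>\<delta>\<^sub>z\<close> with \<open>z \<in> G\<^sub>k\<close>.  These spans increase to a
  dense subspace of \<open>Fin\<close>, so the projections converge to \<open>f\<^sub>x - f\<^sub>y\<close>.
  
  Uniqueness of the embeddings is then a general fact: by polarization the distances determine the
  Gram matrix of the vectors \<open>k x - k x0\<close>, and two families with the same Gram matrix are matched by
  an isometry between their closed spans (\<open>isometry_of_equal_gram\<close>).  The dipoles span a dense
  subspace because a gradient orthogonal to all of them belongs to a constant function, and their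
  projections inherit this inside \<open>Fin\<close>.
\<close>

section \<open>The Hilbert space of square summable families\<close>

lemma square_summable_mult:
  fixes f g :: "'a \<Rightarrow> real"
  assumes "(\<lambda>i. (f i)\<^sup>2) summable_on A" "(\<lambda>i. (g i)\<^sup>2) summable_on A"
  shows "(\<lambda>i. f i * g i) summable_on A"
proof (rule abs_summable_summable, rule abs_summable_product)
  show "(\<lambda>i. norm (f i * f i)) summable_on A" "(\<lambda>i. norm (g i * g i)) summable_on A"
    using assms by (simp_all flip: power2_eq_square)
qed

lemma square_summable_add:
  fixes f g :: "'a \<Rightarrow> real"
  assumes "(\<lambda>i. (f i)\<^sup>2) summable_on A" "(\<lambda>i. (g i)\<^sup>2) summable_on A"
  shows "(\<lambda>i. (f i + g i)\<^sup>2) summable_on A"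
proof -
  have "(\<lambda>i. (f i)\<^sup>2 + (g i)\<^sup>2 + 2 * (f i * g i)) summable_on A"
    by (intro summable_on_add assms summable_on_cmult_right square_summable_mult)
  then show ?thesis
    by (simp add: power2_sum mult.assoc)
qed

typedef 'a ell2 = "{f :: 'a \<Rightarrow> real. (\<lambda>i. (f i)\<^sup>2) summable_on UNIV}"
  morphisms coord Abs_ell2
  by (rule exI[of _ "\<lambda>_. 0"]) simp

setup_lifting type_definition_ell2

lemma coord_square_summable: "(\<lambda>i. (coord x i)\<^sup>2) summable_on UNIV"
  using coord[of x] by simp

instantiation ell2 :: (type) real_inner
begin

lift_definition zero_ell2 :: "'a ell2" is "\<lambda>_. 0"
  by simp

lift_definition plus_ell2 :: "'a ell2 \<Rightarrow> 'a ell2 \<Rightarrow> 'a ell2" is "\<lambda>f g i. f i + g i"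
  by (rule square_summable_add)

lift_definition scaleR_ell2 :: "real \<Rightarrow> 'a ell2 \<Rightarrow> 'a ell2" is "\<lambda>r f i. r * f i"
  by (simp add: power_mult_distrib summable_on_cmult_right)

lift_definition uminus_ell2 :: "'a ell2 \<Rightarrow> 'a ell2" is "\<lambda>f i. - f i"
  by simp

lift_definition minus_ell2 :: "'a ell2 \<Rightarrow> 'a ell2 \<Rightarrow> 'a ell2" is "\<lambda>f g i. f i - g i"
  using square_summable_add[of _ UNIV "\<lambda>i. - _ i"] by simp

lift_definition inner_ell2 :: "'a ell2 \<Rightarrow> 'a ell2 \<Rightarrow> real" is "\<lambda>f g. \<Sum>\<^sub>\<infinity>i. f i * g i" .

definition norm_ell2 :: "'a ell2 \<Rightarrow> real" where
  "norm_ell2 x = sqrt (inner x x)"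

definition dist_ell2 :: "'a ell2 \<Rightarrow> 'a ell2 \<Rightarrow> real" where
  "dist_ell2 x y = norm (x - y)"

definition sgn_ell2 :: "'a ell2 \<Rightarrow> 'a ell2" where
  "sgn_ell2 x = inverse (norm x) *\<^sub>R x"

definition uniformity_ell2 :: "('a ell2 \<times> 'a ell2) filter" where
  "uniformity_ell2 = (INF e\<in>{0<..}. principal {(x, y). dist x y < e})"

definition open_ell2 :: "'a ell2 set \<Rightarrow> bool" where
  "open_ell2 U \<longleftrightarrow> (\<forall>x\<in>U. eventually (\<lambda>(x', y). x' = x \<longrightarrow> y \<in> U) uniformity)"

instance
proof
  fix x y z :: "'a ell2" and r s :: real
  show "x + y + z = x + (y + z)" "x + y = y + x" "0 + x = x" "- x + x = 0" "x - y = x + - y"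
    by (transfer; simp add: algebra_simps)+
  show "r *\<^sub>R (x + y) = r *\<^sub>R x + r *\<^sub>R y" "(r + s) *\<^sub>R x = r *\<^sub>R x + s *\<^sub>R x"
    "r *\<^sub>R s *\<^sub>R x = (r * s) *\<^sub>R x" "1 *\<^sub>R x = x"
    by (transfer; simp add: algebra_simps)+
  show "sgn x = inverse (norm x) *\<^sub>R x"
    by (rule sgn_ell2_def)
  show "dist x y = norm (x - y)"
    by (rule dist_ell2_def)
  show "(uniformity :: ('a ell2 \<times> 'a ell2) filter) = (INF e\<in>{0<..}. principal {(x, y). dist x y < e})"
    by (rule uniformity_ell2_def)
  show "open U = (\<forall>x\<in>U. eventually (\<lambda>(x', y). x' = x \<longrightarrow> y \<in> U) uniformity)" for U :: "'a ell2 set"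
    by (rule open_ell2_def)
  show "inner x y = inner y x"
    by transfer (simp add: mult.commute)
  show "inner (x + y) z = inner x z + inner y z"
    by transfer (simp add: distrib_right infsum_add square_summable_mult)
  show "inner (r *\<^sub>R x) y = r * inner x y"
    by transfer (simp add: mult.assoc infsum_cmult_right')
  show "0 \<le> inner x x"
    by transfer (simp add: infsum_nonneg)
  show "inner x x = 0 \<longleftrightarrow> x = 0"
  proof
    assume "inner x x = 0"
    then have "coord x i = 0" for i
      using nonneg_infsum_le_0D[of "\<lambda>i. coord x i * coord x i" UNIV i] coord_square_summable[of x]
      by (simp add: inner_ell2.rep_eq power2_eq_square)
    then show "x = 0"
      by transfer auto
  qed (transfer, simp)
  show "norm x = sqrt (inner x x)"
    by (rule norm_ell2_def)
qed

end

lemma coord_simps [simp]: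
  "coord 0 i = 0" "coord (x + y) i = coord x i + coord y i" "coord (x - y) i = coord x i - coord y i"
  "coord (r *\<^sub>R x) i = r * coord x i"
  by (transfer; simp)+

lemma norm_ell2_eq: "(norm x)\<^sup>2 = (\<Sum>\<^sub>\<infinity>i. (coord x i)\<^sup>2)"
  unfolding power2_norm_eq_inner inner_ell2.rep_eq by (simp add: power2_eq_square)

lemma sum_coord_le_norm:
  assumes "finite F"
  shows "(\<Sum>i\<in>F. (coord x i)\<^sup>2) \<le> (norm x)\<^sup>2"
  using finite_sum_le_infsum[OF coord_square_summable assms] by (simp add: norm_ell2_eq)

lemma abs_coord_le_norm: "\<bar>coord x i\<bar> \<le> norm x"
  using sum_coord_le_norm[of "{i}" x] power2_le_imp_le[of "\<bar>coord x i\<bar>" "norm x"] by simp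

lemma bounded_linear_coord: "bounded_linear (\<lambda>x. coord x i)"
  by (rule bounded_linear_intro[of _ 1]) (simp_all add: abs_coord_le_norm)

lemmas tendsto_coord = bounded_linear.tendsto[OF bounded_linear_coord]

text \<open>
  Square summability and the norm only involve finite partial sums, and these pass to
  coordinatewise limits.
\<close>
lemma ell2_of_bounded_sums:
  fixes f :: "'a \<Rightarrow> real"
  assumes "\<And>F. finite F \<Longrightarrow> (\<Sum>i\<in>F. (f i)\<^sup>2) \<le> C\<^sup>2" "0 \<le> C"
  obtains x where "coord x = f" "norm x \<le> C"
proof -
  have sm: "(\<lambda>i. (f i)\<^sup>2) summable_on UNIV"
    by (rule nonneg_bdd_above_summable_on) (use assms in \<open>auto intro!: bdd_aboveI2\<close>)
  then have f: "coord (Abs_ell2 f) = f"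
    by (simp add: Abs_ell2_inverse)
  have "(norm (Abs_ell2 f))\<^sup>2 = (\<Sum>\<^sub>\<infinity>i. (f i)\<^sup>2)"
    by (simp add: norm_ell2_eq f)
  also have "\<dots> \<le> C\<^sup>2"
    by (rule infsum_le_finite_sums[OF sm]) (use assms in auto)
  finally have "norm (Abs_ell2 f) \<le> C"
    using assms(2) by (rule power2_le_imp_le)
  with f show thesis
    by (rule that)
qed

instance ell2 :: (type) complete_space
proof
  fix X :: "nat \<Rightarrow> 'a ell2"
  assume X: "Cauchy X"
  have "convergent (\<lambda>n. coord (X n) i)" for i
    using bounded_linear.Cauchy[OF bounded_linear_coord X] by (rule Cauchy_convergent)
  then obtain f where f: "\<And>i. (\<lambda>n. coord (X n) i) \<longlonglongrightarrow> f i"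
    unfolding convergent_def by metis
  have close: "\<exists>x. coord x = (\<lambda>i. coord (X m) i - f i) \<and> norm x \<le> e"
    if m: "\<forall>n\<ge>m. norm (X m - X n) < e" and "0 < e" for m e
  proof -
    have "(\<Sum>i\<in>F. (coord (X m) i - f i)\<^sup>2) \<le> e\<^sup>2" if "finite F" for F
    proof (rule tendsto_upperbound)
      show "(\<lambda>n. \<Sum>i\<in>F. (coord (X m) i - coord (X n) i)\<^sup>2) \<longlonglongrightarrow> (\<Sum>i\<in>F. (coord (X m) i - f i)\<^sup>2)"
        by (intro tendsto_intros f)
      have "(\<Sum>i\<in>F. (coord (X m) i - coord (X n) i)\<^sup>2) \<le> e\<^sup>2" if "m \<le> n" for n
        using sum_coord_le_norm[OF \<open>finite F\<close>, of "X m - X n"] m that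
          power_mono[of "norm (X m - X n)" e 2] by force
      then show "eventually (\<lambda>n. (\<Sum>i\<in>F. (coord (X m) i - coord (X n) i)\<^sup>2) \<le> e\<^sup>2) sequentially"
        using eventually_sequentially by blast
    qed simp
    then obtain x where "coord x = (\<lambda>i. coord (X m) i - f i)" "norm x \<le> e"
      by (rule ell2_of_bounded_sums[OF _ less_imp_le[OF \<open>0 < e\<close>]])
    then show ?thesis
      by blast
  qed
  have cau: "\<exists>M. \<forall>m\<ge>M. \<forall>n\<ge>m. norm (X m - X n) < e" if "0 < e" for e
    using X that unfolding Cauchy_def dist_norm by (meson order_trans)
  obtain M where "\<forall>n\<ge>M. norm (X M - X n) < 1"
    using cau[OF zero_less_one] by blast
  then obtain x where x: "coord x = (\<lambda>i. coord (X M) i - f i)"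
    using close[of M 1] zero_less_one by blast
  define l where "l = X M - x"
  have l: "coord l = f"
    unfolding l_def by (rule ext) (simp add: x)
  have "X \<longlonglongrightarrow> l"
  proof (rule LIMSEQ_I)
    fix e :: real
    assume "0 < e"
    then obtain N where N: "\<And>m. m \<ge> N \<Longrightarrow> \<forall>n\<ge>m. norm (X m - X n) < e / 2"
      using cau[OF half_gt_zero] by blast
    have "norm (X m - l) < e" if m: "N \<le> m" for m
    proof -
      obtain y where y: "coord y = (\<lambda>i. coord (X m) i - f i)" "norm y \<le> e / 2"
        using close[of m "e / 2", OF N[OF m]] half_gt_zero[OF \<open>0 < e\<close>] by blast
      have "coord y = coord (X m - l)"
        by (rule ext) (simp add: y l)
      then have "y = X m - l"
        by (simp add: coord_inject)
      with y(2) \<open>0 < e\<close> show ?thesis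
        by simp
    qed
    then show "\<exists>N. \<forall>n\<ge>N. norm (X n - l) < e"
      by blast
  qed
  then show "convergent X"
    by (rule convergentI)
qed


section \<open>Projections and isometries in Hilbert spaces\<close>

lemma subspace_closure:
  fixes S :: "'a::real_normed_vector set"
  assumes S: "subspace S"
  shows "subspace (closure S)"
proof (rule subspaceI)
  show "0 \<in> closure S"
    using subspace_0[OF S] closure_subset by blast
next
  fix x y
  assume "x \<in> closure S" "y \<in> closure S"
  then obtain f g where "\<And>n. f n \<in> S" "f \<longlonglongrightarrow> x" "\<And>n. g n \<in> S" "g \<longlonglongrightarrow> y"
    unfolding closure_sequential by blast
  then have "\<And>n. f n + g n \<in> S" "(\<lambda>n. f n + g n) \<longlonglongrightarrow> x + y"
    by (auto intro: subspace_add[OF S] tendsto_add)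
  then show "x + y \<in> closure S"
    unfolding closure_sequential by (intro exI[of _ "\<lambda>n. f n + g n"]) simp
next
  fix r x
  assume "x \<in> closure S"
  then obtain f where "\<And>n. f n \<in> S" "f \<longlonglongrightarrow> x"
    unfolding closure_sequential by blast
  then have "\<And>n. r *\<^sub>R f n \<in> S" "(\<lambda>n. r *\<^sub>R f n) \<longlonglongrightarrow> r *\<^sub>R x"
    by (auto intro: subspace_scale[OF S] tendsto_scaleR)
  then show "r *\<^sub>R x \<in> closure S"
    unfolding closure_sequential by (intro exI[of _ "\<lambda>n. r *\<^sub>R f n"]) simp
qed

lemma closest_point_orthogonal:
  fixes x p :: "'a::real_inner"
  assumes S: "subspace S" and p: "p \<in> S" "\<And>s. s \<in> S \<Longrightarrow> norm (x - p) \<le> norm (x - s)" and s: "s \<in> S"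
  shows "inner (x - p) s = 0"
proof (cases "s = 0")
  case False
  \<comment> \<open>the parameter minimizing the distance from x to the line through p in direction s\<close>
  define t where "t = inner (x - p) s / inner s s"
  have "p + t *\<^sub>R s \<in> S"
    using S p(1) s by (simp add: subspace_add subspace_scale)
  then have "(norm (x - p))\<^sup>2 \<le> (norm (x - p - t *\<^sub>R s))\<^sup>2"
    using p(2)[of "p + t *\<^sub>R s"] by (simp add: diff_diff_eq power_mono)
  also have "\<dots> = (norm (x - p))\<^sup>2 - 2 * t * inner (x - p) s + t * t * inner s s"
    unfolding power2_norm_eq_inner inner_diff_left[of "x - p"] inner_diff_right[of _ "x - p"]
    by (simp add: inner_commute)
  also have "\<dots> = (norm (x - p))\<^sup>2 - (inner (x - p) s)\<^sup>2 / inner s s"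
    using False by (simp add: t_def power2_eq_square)
  finally have "(inner (x - p) s)\<^sup>2 / inner s s \<le> 0"
    by simp
  moreover have "0 < inner s s"
    using False by simp
  ultimately show ?thesis
    by (simp add: divide_le_0_iff)
qed simp

text \<open>
  A sequence in \<open>S\<close> minimizing the distance to \<open>x\<close> is Cauchy by the parallelogram law.
\<close>
lemma closest_point_exists:
  fixes x :: "'a::{real_inner, complete_space}"
  assumes S: "subspace S" "closed S"
  obtains p where "p \<in> S" "\<And>s. s \<in> S \<Longrightarrow> norm (x - p) \<le> norm (x - s)"
proof -
  define N where "N = (\<lambda>s. (norm (x - s))\<^sup>2) ` S"
  define m where "m = Inf N"
  have ne: "N \<noteq> {}" and bdd: "bdd_below N"
    using subspace_0[OF S(1)] by (auto simp: N_def intro!: bdd_belowI[of _ 0])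
  have m: "m \<le> (norm (x - s))\<^sup>2" if "s \<in> S" for s
    unfolding m_def using that bdd by (intro cInf_lower) (auto simp: N_def)
  have "\<exists>s\<in>S. (norm (x - s))\<^sup>2 < m + inverse (real (Suc n))" for n
  proof -
    have "Inf N < m + inverse (real (Suc n))"
      by (simp add: m_def)
    from cInf_lessD[OF ne this] show ?thesis
      by (auto simp: N_def)
  qed
  then obtain s where s: "\<And>n. s n \<in> S" "\<And>n. (norm (x - s n))\<^sup>2 < m + inverse (real (Suc n))"
    by metis
  \<comment> \<open>parallelogram law, using that the midpoint of two points of \<open>S\<close> is no closer than \<open>m\<close>\<close>
  have par: "(norm (s i - s j))\<^sup>2 \<le> 2 * inverse (real (Suc i)) + 2 * inverse (real (Suc j))" for i j
  proof -
    have "(1 / 2) *\<^sub>R (s i + s j) \<in> S"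
      using S(1) s(1) by (simp add: subspace_add subspace_scale)
    then have "m \<le> (norm (x - (1 / 2) *\<^sub>R (s i + s j)))\<^sup>2"
      by (rule m)
    moreover have "(norm (s i - s j))\<^sup>2 = 2 * (norm (x - s i))\<^sup>2 + 2 * (norm (x - s j))\<^sup>2
        - 4 * (norm (x - (1 / 2) *\<^sub>R (s i + s j)))\<^sup>2"
      unfolding power2_norm_eq_inner by (simp add: inner_diff inner_add inner_commute algebra_simps)
    ultimately show ?thesis
      using s(2)[of i] s(2)[of j] by linarith
  qed
  have "Cauchy s"
  proof (rule CauchyI)
    fix e :: real
    assume "0 < e"
    then obtain M where M: "inverse (real (Suc M)) < e\<^sup>2 / 4"
      using reals_Archimedean[of "e\<^sup>2 / 4"] by auto
    have "norm (s i - s j) < e" if "M \<le> i" "M \<le> j" for i j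
    proof -
      have "inverse (real (Suc i)) \<le> inverse (real (Suc M))" "inverse (real (Suc j)) \<le> inverse (real (Suc M))"
        using that by (auto intro!: le_imp_inverse_le)
      then have "(norm (s i - s j))\<^sup>2 < e\<^sup>2"
        using par[of i j] M by linarith
      with \<open>0 < e\<close> show ?thesis
        by (simp add: power2_less_imp_less)
    qed
    then show "\<exists>M. \<forall>m\<ge>M. \<forall>n\<ge>M. norm (s m - s n) < e"
      by blast
  qed
  then obtain p where p: "s \<longlonglongrightarrow> p"
    using Cauchy_convergent convergent_def by blast
  have "(\<lambda>n. m + inverse (real (Suc n))) \<longlonglongrightarrow> m + 0"
    by (intro tendsto_intros LIMSEQ_inverse_real_of_nat)
  then have "(norm (x - p))\<^sup>2 \<le> m + 0"
    by (rule LIMSEQ_le[of "\<lambda>n. (norm (x - s n))\<^sup>2", rotated])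
      (auto intro!: tendsto_intros p simp del: of_nat_Suc intro: less_imp_le s(2))
  then have "norm (x - p) \<le> norm (x - t)" if "t \<in> S" for t
    using m[OF that] by (auto intro: power2_le_imp_le[OF order_trans])
  moreover have "p \<in> S"
    using closed_sequentially[OF S(2)] s(1) p by blast
  ultimately show thesis
    by (rule that[rotated])
qed

text \<open>
  Only meaningful when \<open>S\<close> is a closed subspace of a complete space; then such a vector exists and is unique.
\<close>
definition orth_proj :: "'a::real_inner set \<Rightarrow> 'a \<Rightarrow> 'a" where
  "orth_proj S x = (SOME p. p \<in> S \<and> (\<forall>s\<in>S. inner (x - p) s = 0))"

lemma orth_proj:
  fixes x :: "'a::{real_inner, complete_space}"
  assumes S: "subspace S" "closed S"
  shows orth_proj_in: "orth_proj S x \<in> S"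
    and orth_proj_inner: "s \<in> S \<Longrightarrow> inner (orth_proj S x) s = inner x s"
proof -
  obtain p where "p \<in> S" "\<And>s. s \<in> S \<Longrightarrow> norm (x - p) \<le> norm (x - s)"
    using closest_point_exists[OF S] by metis
  with closest_point_orthogonal[OF S(1)] have "\<exists>p. p \<in> S \<and> (\<forall>s\<in>S. inner (x - p) s = 0)"
    by blast
  then have *: "orth_proj S x \<in> S \<and> (\<forall>s\<in>S. inner (x - orth_proj S x) s = 0)"
    unfolding orth_proj_def by (rule someI_ex)
  then show "orth_proj S x \<in> S" "s \<in> S \<Longrightarrow> inner (orth_proj S x) s = inner x s"
    by (auto simp: inner_diff_left)
qed

lemma eq_if_inner_eq:
  fixes p q :: "'a::real_inner"
  assumes "subspace S" "p \<in> S" "q \<in> S" "\<And>s. s \<in> S \<Longrightarrow> inner p s = inner q s"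
  shows "p = q"
proof -
  have "inner (p - q) (p - q) = 0"
    using assms(4)[OF subspace_diff[OF assms(1-3)]] by (simp add: inner_diff_left)
  then show ?thesis
    by simp
qed

text \<open>
  Otherwise the component of some \<open>x \<in> S\<close> orthogonal to the closed span of \<open>T\<close> would be a nonzero
  vector of \<open>S\<close> orthogonal to all of \<open>T\<close>.
\<close>
lemma closure_span_eq_if_total:
  fixes T :: "'a::{real_inner, complete_space} set"
  assumes S: "subspace S" "closed S" and T: "T \<subseteq> S"
    and total: "\<And>w. w \<in> S \<Longrightarrow> (\<And>t. t \<in> T \<Longrightarrow> inner w t = 0) \<Longrightarrow> w = 0"
  shows "closure (span T) = S"
proof
  show sub: "closure (span T) \<subseteq> S"
    using S T by (simp add: closure_minimal span_minimal)
  show "S \<subseteq> closure (span T)"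
  proof
    fix x
    assume x: "x \<in> S"
    have cs: "subspace (closure (span T))" "closed (closure (span T))"
      by (simp_all add: subspace_closure)
    let ?p = "orth_proj (closure (span T)) x"
    have p: "?p \<in> closure (span T)"
      by (rule orth_proj_in[OF cs])
    have "x - ?p = 0"
    proof (rule total)
      show "x - ?p \<in> S"
        using S(1) x p sub by (blast intro: subspace_diff)
      fix t
      assume "t \<in> T"
      then have "t \<in> closure (span T)"
        using closure_subset span_base by blast
      then show "inner (x - ?p) t = 0"
        using orth_proj_inner[OF cs, of t x] by (simp add: inner_diff_left)
    qed
    with p show "x \<in> closure (span T)"
      by simp
  qed
qed

text \<open>
  The isometry matching two families with equal Gram matrices is built through its graph, the closed
  span \<open>G\<close> of the pairs.  Working with the graph makes linearity immediate and avoids having to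
  check that the assignment on linear combinations is well defined.
  The equality of inner products is bilinear and continuous, so it spreads from the generators to \<open>G\<close>
  in one argument at a time.
\<close>
lemma closed_span_preserves_inner:
  fixes I :: "'i set" and a :: "'i \<Rightarrow> 'p::real_inner" and b :: "'i \<Rightarrow> 'q::real_inner"
  assumes ab: "\<And>i j. i \<in> I \<Longrightarrow> j \<in> I \<Longrightarrow> inner (a i) (a j) = inner (b i) (b j)"
  defines "G \<equiv> closure (span ((\<lambda>i. (a i, b i)) ` I))"
  assumes z: "z \<in> G" "z' \<in> G"
  shows "inner (fst z) (fst z') = inner (snd z) (snd z')"
proof -
  let ?X = "(\<lambda>i. (a i, b i)) ` I"
  have sub: "G \<subseteq> {z. inner (fst z) (fst w) = inner (snd z) (snd w)}"
    if "\<And>v. v \<in> ?X \<Longrightarrow> inner (fst v) (fst w) = inner (snd v) (snd w)" for w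
    unfolding G_def
  proof (intro closure_minimal span_minimal)
    show "subspace {z. inner (fst z) (fst w) = inner (snd z) (snd w)}"
      by (simp add: subspace_def inner_add_left)
    show "closed {z. inner (fst z) (fst w) = inner (snd z) (snd w)}"
      by (intro closed_Collect_eq continuous_intros)
  qed (use that in auto)
  have "inner (fst v) (fst z') = inner (snd v) (snd z')" if v: "v \<in> ?X" for v
  proof -
    have "G \<subseteq> {z. inner (fst z) (fst v) = inner (snd z) (snd v)}"
      by (rule sub) (use v ab in auto)
    with z(2) show ?thesis
      by (auto simp: inner_commute)
  qed
  with sub[of z'] z(1) show ?thesis
    by auto
qed

text \<open>
  The norms of the two components of an element of the graph agree, so convergence of the first
  components forces convergence of the second ones: projecting the graph loses no limit points.
\<close>
lemma closed_span_fst: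
  fixes I :: "'i set" and a :: "'i \<Rightarrow> 'p::{real_inner, complete_space}"
    and b :: "'i \<Rightarrow> 'q::{real_inner, complete_space}"
  assumes ab: "\<And>i j. i \<in> I \<Longrightarrow> j \<in> I \<Longrightarrow> inner (a i) (a j) = inner (b i) (b j)"
  defines "G \<equiv> closure (span ((\<lambda>i. (a i, b i)) ` I))"
  shows "fst ` G = closure (span (a ` I))"
proof
  let ?X = "(\<lambda>i. (a i, b i)) ` I"
  have fst: "fst ` span ?X = span (a ` I)"
    using linear_span_image[OF linear_fst, of ?X] by (simp add: image_image)
  show "fst ` G \<subseteq> closure (span (a ` I))"
    unfolding G_def fst[symmetric]
    by (rule image_closure_subset) (auto intro!: continuous_intros closure_subset)
  show "closure (span (a ` I)) \<subseteq> fst ` G"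
  proof
    fix p
    assume "p \<in> closure (span (a ` I))"
    then obtain P where P: "\<And>n. P n \<in> span (a ` I)" "P \<longlonglongrightarrow> p"
      unfolding closure_sequential by blast
    have "\<exists>q. (P n, q) \<in> span ?X" for n
    proof -
      have "P n \<in> fst ` span ?X"
        unfolding fst by (rule P(1))
      then show ?thesis
        by force
    qed
    then obtain Q where Q: "\<And>n. (P n, Q n) \<in> span ?X"
      by metis
    have "norm (P m - P n) = norm (Q m - Q n)" for m n
    proof -
      have "(P m - P n, Q m - Q n) \<in> closure (span ?X)"
        using subspace_diff[OF subspace_span Q[of m] Q[of n]] closure_subset by auto
      from closed_span_preserves_inner[OF ab this this] show ?thesis
        by (simp add: norm_eq_sqrt_inner)
    qed
    then have "Cauchy Q"
      using LIMSEQ_imp_Cauchy[OF P(2)] unfolding Cauchy_iff by simp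
    then obtain q where "Q \<longlonglongrightarrow> q"
      using Cauchy_convergent convergent_def by blast
    with P(2) have "(\<lambda>n. (P n, Q n)) \<longlonglongrightarrow> (p, q)"
      by (rule tendsto_Pair)
    with Q have "(p, q) \<in> G"
      unfolding G_def closure_sequential by (intro exI[of _ "\<lambda>n. (P n, Q n)"]) simp
    then show "p \<in> fst ` G"
      by force
  qed
qed

lemma closed_span_swap:
  fixes a :: "'i \<Rightarrow> 'p::real_inner" and b :: "'i \<Rightarrow> 'q::real_inner"
  assumes "z \<in> closure (span ((\<lambda>i. (a i, b i)) ` I))"
  shows "prod.swap z \<in> closure (span ((\<lambda>i. (b i, a i)) ` I))"
proof -
  have "linear (prod.swap :: 'p \<times> 'q \<Rightarrow> 'q \<times> 'p)"
    by (auto intro!: linearI)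
  from linear_span_image[OF this, of "(\<lambda>i. (a i, b i)) ` I"]
  have "prod.swap ` span ((\<lambda>i. (a i, b i)) ` I) = span ((\<lambda>i. (b i, a i)) ` I)"
    by (simp add: image_image)
  moreover have "continuous_on UNIV (prod.swap :: 'p \<times> 'q \<Rightarrow> 'q \<times> 'p)"
    unfolding prod.swap_def by (intro continuous_intros)
  ultimately have "prod.swap ` closure (span ((\<lambda>i. (a i, b i)) ` I))
      \<subseteq> closure (span ((\<lambda>i. (b i, a i)) ` I))"
    by (intro image_closure_subset) (auto intro: continuous_on_subset closure_subset[THEN subsetD])
  with assms show ?thesis
    by blast
qed

text \<open>
  Density of the span of the first family makes the graph total, and the preserved norm makes it single-valued.
  The range is read off from the graph with its components exchanged.
\<close>
lemma isometry_of_equal_gram: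
  fixes I :: "'i set" and a :: "'i \<Rightarrow> 'p::{real_inner, complete_space}"
    and b :: "'i \<Rightarrow> 'q::{real_inner, complete_space}"
  assumes ab: "\<And>i j. i \<in> I \<Longrightarrow> j \<in> I \<Longrightarrow> inner (a i) (a j) = inner (b i) (b j)"
    and dense: "closure (span (a ` I)) = UNIV"
  obtains U where "linear U" "\<And>x y. inner (U x) (U y) = inner x y"
    "range U = closure (span (b ` I))" "\<And>i. i \<in> I \<Longrightarrow> U (a i) = b i"
proof -
  define G where "G = closure (span ((\<lambda>i. (a i, b i)) ` I))"
  have G: "subspace G"
    by (simp add: G_def subspace_closure)
  have iso: "inner x x' = inner y y'" if "(x, y) \<in> G" "(x', y') \<in> G" for x y x' y'
    using closed_span_preserves_inner[OF ab] that unfolding G_def by fastforce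
  have uniq: "y = y'" if "(x, y) \<in> G" "(x, y') \<in> G" for x y y'
  proof -
    have "(0, y - y') \<in> G"
      using subspace_diff[OF G that] by simp
    from iso[OF this this] show ?thesis
      by simp
  qed
  have "\<exists>y. (x, y) \<in> G" for x
  proof -
    have "x \<in> fst ` G"
      using closed_span_fst[OF ab, where I = I] dense by (simp add: G_def)
    then show ?thesis
      by force
  qed
  then obtain U where U: "\<And>x. (x, U x) \<in> G"
    by metis
  have U_eq: "U x = y" if "(x, y) \<in> G" for x y
    using uniq[OF U that] .
  show thesis
  proof
    show "linear U"
    proof (rule linearI)
      show "U (x + y) = U x + U y" for x y
        using subspace_add[OF G U U, of x y] by (intro U_eq) simp
      show "U (r *\<^sub>R x) = r *\<^sub>R U x" for r x
        using subspace_scale[OF G U, of r x] by (intro U_eq) simp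
    qed
    show "inner (U x) (U y) = inner x y" for x y
      using iso[OF U U] by simp
    show "U (a i) = b i" if "i \<in> I" for i
      using that unfolding G_def[symmetric]
      by (intro U_eq) (auto simp: G_def intro!: closure_subset[THEN subsetD] span_base)
    have "range U = fst ` closure (span ((\<lambda>i. (b i, a i)) ` I))"
    proof (intro equalityI subsetI)
      fix y
      assume "y \<in> range U"
      then obtain x where "(x, y) \<in> G"
        using U by blast
      from closed_span_swap[OF this[unfolded G_def]]
      show "y \<in> fst ` closure (span ((\<lambda>i. (b i, a i)) ` I))"
        by (force intro: rev_image_eqI)
    next
      fix y
      assume "y \<in> fst ` closure (span ((\<lambda>i. (b i, a i)) ` I))"
      then obtain x where "(y, x) \<in> closure (span ((\<lambda>i. (b i, a i)) ` I))"
        by auto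
      from closed_span_swap[OF this] have "U x = y"
        by (intro U_eq) (simp add: G_def)
      then show "y \<in> range U"
        by blast
    qed
    also have "\<dots> = closure (span (b ` I))"
      using closed_span_fst[of I b a] ab by simp
    finally show "range U = closure (span (b ` I))" .
  qed
qed

text \<open>
  Here \<open>\<parallel>g k - g l\<parallel>\<^sup>2 = \<parallel>g k\<parallel>\<^sup>2 - \<parallel>g l\<parallel>\<^sup>2\<close>, so the norms decrease, and their convergence makes \<open>g\<close>
  Cauchy.
\<close>
lemma convergent_if_inner_antitone:
  fixes g :: "nat \<Rightarrow> 'a::{real_inner, complete_space}"
  assumes g: "\<And>k l. k \<le> l \<Longrightarrow> inner (g k) (g l) = inner (g l) (g l)"
  shows "convergent g"
proof -
  define N where "N k = inner (g k) (g k)" for k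
  have diff: "(norm (g k - g l))\<^sup>2 = N k - N l" if "k \<le> l" for k l
    unfolding power2_norm_eq_inner N_def using g[OF that] by (simp add: inner_diff inner_commute)
  have "decseq N"
    unfolding decseq_def using diff by (metis diff_ge_0_iff_ge zero_le_power2)
  moreover have "\<And>k. 0 \<le> N k"
    by (simp add: N_def)
  ultimately have "convergent N"
    using decseq_convergent[of N 0] by (metis convergentI)
  then have "Cauchy N"
    by (rule convergent_Cauchy)
  have "Cauchy g"
  proof (rule CauchyI')
    fix e :: real
    assume "0 < e"
    then obtain M where M: "\<And>m n. m \<ge> M \<Longrightarrow> n \<ge> M \<Longrightarrow> \<bar>N m - N n\<bar> < e\<^sup>2"
      using \<open>Cauchy N\<close> unfolding Cauchy_iff by (metis real_norm_def zero_less_power)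
    have "norm (g m - g n) < e" if "M \<le> m" "m < n" for m n
    proof (rule power2_less_imp_less)
      show "(norm (g m - g n))\<^sup>2 < e\<^sup>2"
        using diff[of m n] M[of m n] that by linarith
    qed (use \<open>0 < e\<close> in simp)
    then show "\<exists>M. \<forall>m\<ge>M. \<forall>n>m. dist (g m) (g n) < e"
      unfolding dist_norm by blast
  qed
  then show ?thesis
    by (rule Cauchy_convergent)
qed

text \<open>
  The hypotheses on \<open>g\<close> say that \<open>g k\<close> is the orthogonal projection of \<open>p\<close> to \<open>F k\<close>, so it is at
  least as close to \<open>p\<close> as any element of \<open>F k\<close>.
\<close>
lemma projections_tendsto:
  fixes p :: "'a::real_inner"
  assumes F: "\<And>k. subspace (F k)" "incseq F" and p: "p \<in> closure (\<Union>k. F k)"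
    and g: "\<And>k. g k \<in> F k" "\<And>k w. w \<in> F k \<Longrightarrow> inner (g k) w = inner p w"
  shows "g \<longlonglongrightarrow> p"
proof (rule LIMSEQ_I)
  fix e :: real
  assume "0 < e"
  with p obtain s K where s: "s \<in> F K" "dist s p < e"
    unfolding closure_approachable by blast
  have "norm (g k - p) < e" if "K \<le> k" for k
  proof -
    have "s \<in> F k"
      using s(1) F(2) that by (auto dest: incseqD)
    then have "s - g k \<in> F k"
      using F(1) g(1) by (simp add: subspace_diff)
    then have "inner (p - g k) (s - g k) = 0"
      using g(2) by (simp add: inner_diff_left)
    then have "(norm (p - s))\<^sup>2 = (norm (p - g k))\<^sup>2 + (norm (s - g k))\<^sup>2"
      unfolding power2_norm_eq_inner by (simp add: inner_diff inner_commute)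
    then have "(norm (p - g k))\<^sup>2 \<le> (norm (p - s))\<^sup>2"
      by simp
    then have "norm (p - g k) \<le> norm (p - s)"
      by (rule power2_le_imp_le) simp
    with s(2) show ?thesis
      by (simp add: dist_norm norm_minus_commute)
  qed
  then show "\<exists>K. \<forall>k\<ge>K. norm (g k - p) < e"
    by blast
qed

lemma span_image_UN:
  fixes f :: "'b \<Rightarrow> 'a::real_vector"
  assumes "\<And>S. finite S \<Longrightarrow> S \<subseteq> V \<Longrightarrow> \<exists>k. S \<subseteq> G k"
  shows "span (f ` V) \<subseteq> (\<Union>k. span (f ` G k))"
proof
  fix s
  assume "s \<in> span (f ` V)"
  then obtain t r where t: "finite t" "t \<subseteq> f ` V" "s = (\<Sum>a\<in>t. r a *\<^sub>R a)"
    unfolding span_explicit by blast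
  then obtain S where S: "finite S" "S \<subseteq> V" "t = f ` S"
    by (meson finite_subset_image)
  then obtain k where "S \<subseteq> G k"
    using assms by blast
  then have "s \<in> span (f ` G k)"
    unfolding t(3) S(3) by (intro span_sum span_scale span_base) auto
  then show "s \<in> (\<Union>k. span (f ` G k))"
    by blast
qed


section \<open>Gradients of functions of finite energy\<close>

text \<open>
  The factor \<open>1 / 2\<close> under the root compensates that the energy counts every edge in both directions.
  The families are indexed by the whole type and vanish outside \<open>V \<times> V\<close>, so that gradients taken in
  different subnetworks of one network live in the same Hilbert space.
\<close>
definition grad :: "'v set \<Rightarrow> ('v \<Rightarrow> 'v \<Rightarrow> real) \<Rightarrow> ('v \<Rightarrow> real) \<Rightarrow> ('v \<times> 'v) ell2" where
  "grad V c u = Abs_ell2 (\<lambda>(x, y). if x \<in> V \<and> y \<in> V then sqrt (c x y / 2) * (u x - u y) else 0)"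

definition grads :: "'v set \<Rightarrow> ('v \<Rightarrow> 'v \<Rightarrow> real) \<Rightarrow> ('v \<times> 'v) ell2 set" where
  "grads V c = grad V c ` dom_energy V c"

locale network =
  fixes V :: "'v set" and c :: "'v \<Rightarrow> 'v \<Rightarrow> real"
  assumes network: "resistance_network V c"
begin

lemma
  assumes "x \<in> V" "y \<in> V"
  shows cond_nonneg: "0 \<le> c x y" and cond_commute: "c x y = c y x"
  using network assms by (auto simp: resistance_network_def)

lemma cond_refl: "x \<in> V \<Longrightarrow> c x x = 0"
  using network by (auto simp: resistance_network_def)

lemma path: "x \<in> V \<Longrightarrow> y \<in> V \<Longrightarrow> (\<lambda>a b. a \<in> V \<and> b \<in> V \<and> 0 < c a b)\<^sup>*\<^sup>* x y"
  using network by (auto simp: resistance_network_def connected_net_def)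

lemma has_sum_neighbours_iff:
  assumes "x \<in> V" "\<And>y. c x y = 0 \<Longrightarrow> f y = 0"
  shows "(f has_sum s) {y \<in> V. 0 < c x y} \<longleftrightarrow> (f has_sum s) V"
proof (rule has_sum_cong_neutral)
  show "f y = 0" if "y \<in> V - {y \<in> V. 0 < c x y}" for y
    using that assms(1) cond_nonneg[of x y] by (auto simp: less_le intro!: assms(2))
qed auto

lemma summable_neighbours_iff:
  assumes "x \<in> V" "\<And>y. c x y = 0 \<Longrightarrow> f y = 0"
  shows "f summable_on {y \<in> V. 0 < c x y} \<longleftrightarrow> f summable_on V"
  by (simp add: summable_on_def has_sum_neighbours_iff[OF assms])

lemma cond_summable: "x \<in> V \<Longrightarrow> c x summable_on V"
  using network summable_neighbours_iff[of x "c x"] by (auto simp: resistance_network_def)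

lemma laplacian_has_sum_iff:
  assumes "x \<in> V"
  shows "((\<lambda>y. c x y * (u x - u y)) has_sum s) V \<longleftrightarrow>
    (\<lambda>y. c x y * (u x - u y)) summable_on V \<and> laplacian V c u x = s"
  unfolding laplacian_def has_sum_neighbours_iff[OF assms, of "\<lambda>y. c x y * (u x - u y)", simplified, symmetric]
    summable_neighbours_iff[OF assms, of "\<lambda>y. c x y * (u x - u y)", simplified, symmetric]
  by (rule has_sum_iff)


lemma grad_coord:
  assumes "u \<in> dom_energy V c"
  shows "coord (grad V c u) (x, y) = (if x \<in> V \<and> y \<in> V then sqrt (c x y / 2) * (u x - u y) else 0)"
proof -
  let ?f = "\<lambda>(x, y). if x \<in> V \<and> y \<in> V then sqrt (c x y / 2) * (u x - u y) else 0"
  have "(\<lambda>p. (1 / 2) * (case p of (x, y) \<Rightarrow> c x y * (u x - u y)\<^sup>2)) summable_on V \<times> V"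
    using assms by (intro summable_on_cmult_right) (simp add: dom_energy_def)
  also have "?this \<longleftrightarrow> (\<lambda>p. (?f p)\<^sup>2) summable_on UNIV"
    by (rule summable_on_cong_neutral) (auto simp: power_mult_distrib cond_nonneg split: if_splits)
  finally show ?thesis
    by (simp add: grad_def Abs_ell2_inverse)
qed

lemma dom_energyI:
  assumes "\<And>x y. x \<in> V \<Longrightarrow> y \<in> V \<Longrightarrow> coord g (x, y) = sqrt (c x y / 2) * (u x - u y)"
  shows "u \<in> dom_energy V c"
proof -
  have "(\<lambda>p. 2 * (coord g p)\<^sup>2) summable_on V \<times> V"
    using summable_on_subset_banach[OF coord_square_summable[of g], of "V \<times> V"]
    by (intro summable_on_cmult_right) simp
  also have "?this \<longleftrightarrow> (\<lambda>(x, y). c x y * (u x - u y)\<^sup>2) summable_on V \<times> V"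
    by (rule summable_on_cong) (auto simp: assms power_mult_distrib cond_nonneg)
  finally show ?thesis
    by (simp add: dom_energy_def)
qed

lemma gradI:
  assumes "\<And>x y. x \<in> V \<Longrightarrow> y \<in> V \<Longrightarrow> coord g (x, y) = sqrt (c x y / 2) * (u x - u y)"
    and "\<And>p. p \<notin> V \<times> V \<Longrightarrow> coord g p = 0"
  shows "u \<in> dom_energy V c" "grad V c u = g"
proof -
  show u: "u \<in> dom_energy V c"
    by (rule dom_energyI) (rule assms(1))
  have "coord (grad V c u) p = coord g p" for p
    using grad_coord[OF u] assms by (cases p) auto
  then show "grad V c u = g"
    by (simp add: coord_inject[symmetric] ext)
qed

lemma grad_outside: "u \<in> dom_energy V c \<Longrightarrow> p \<notin> V \<times> V \<Longrightarrow> coord (grad V c u) p = 0"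
  by (cases p) (auto simp: grad_coord)

lemma coord_grad_mult:
  assumes "u \<in> dom_energy V c" "w \<in> dom_energy V c" "x \<in> V" "y \<in> V"
  shows "coord (grad V c u) (x, y) * coord (grad V c w) (x, y) = c x y * (u x - u y) * (w x - w y) / 2"
proof -
  have "coord (grad V c u) (x, y) * coord (grad V c w) (x, y)
      = (sqrt (c x y / 2) * sqrt (c x y / 2)) * ((u x - u y) * (w x - w y))"
    using assms by (simp only: grad_coord ac_simps simp_thms if_True)
  also have "sqrt (c x y / 2) * sqrt (c x y / 2) = c x y / 2"
    using cond_nonneg[OF assms(3,4)] by simp
  finally show ?thesis
    by simp
qed

lemma
  assumes "u \<in> dom_energy V c" "w \<in> dom_energy V c"
  shows dom_energy_add: "(\<lambda>x. u x + w x) \<in> dom_energy V c"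
    and grad_add: "grad V c (\<lambda>x. u x + w x) = grad V c u + grad V c w"
  by (rule gradI[where g = "grad V c u + grad V c w"];
    simp add: grad_coord grad_outside assms algebra_simps)+

lemma
  assumes "u \<in> dom_energy V c" "w \<in> dom_energy V c"
  shows dom_energy_diff: "(\<lambda>x. u x - w x) \<in> dom_energy V c"
    and grad_diff: "grad V c (\<lambda>x. u x - w x) = grad V c u - grad V c w"
  by (rule gradI[where g = "grad V c u - grad V c w"];
    simp add: grad_coord grad_outside assms algebra_simps)+

lemma
  assumes "u \<in> dom_energy V c"
  shows dom_energy_scale: "(\<lambda>x. r * u x) \<in> dom_energy V c"
    and grad_scale: "grad V c (\<lambda>x. r * u x) = r *\<^sub>R grad V c u"
  by (rule gradI[where g = "r *\<^sub>R grad V c u"];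
    simp add: grad_coord grad_outside assms algebra_simps)+

lemma dom_energy_zero: "(\<lambda>_. 0) \<in> dom_energy V c"
  and grad_zero: "grad V c (\<lambda>_. 0) = 0"
  using gradI[of 0 "\<lambda>_. 0"] by auto

lemma
  assumes "finite S" "\<And>i. i \<in> S \<Longrightarrow> u i \<in> dom_energy V c"
  shows dom_energy_sum: "(\<lambda>x. \<Sum>i\<in>S. a i * u i x) \<in> dom_energy V c"
    and grad_sum: "grad V c (\<lambda>x. \<Sum>i\<in>S. a i * u i x) = (\<Sum>i\<in>S. a i *\<^sub>R grad V c (u i))"
proof -
  have "(\<lambda>x. \<Sum>i\<in>S. a i * u i x) \<in> dom_energy V c \<and>
    grad V c (\<lambda>x. \<Sum>i\<in>S. a i * u i x) = (\<Sum>i\<in>S. a i *\<^sub>R grad V c (u i))"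
    using assms
  proof (induction S)
    case (insert j S)
    then show ?case
      using dom_energy_add[of "\<lambda>x. a j * u j x" "\<lambda>x. \<Sum>i\<in>S. a i * u i x"]
        grad_add[of "\<lambda>x. a j * u j x" "\<lambda>x. \<Sum>i\<in>S. a i * u i x"]
        dom_energy_scale[of "u j" "a j"] grad_scale[of "u j" "a j"] by simp
  qed (simp_all add: dom_energy_zero grad_zero)
  then show "(\<lambda>x. \<Sum>i\<in>S. a i * u i x) \<in> dom_energy V c"
    "grad V c (\<lambda>x. \<Sum>i\<in>S. a i * u i x) = (\<Sum>i\<in>S. a i *\<^sub>R grad V c (u i))"
    by auto
qed

lemma grad_cong: "(\<And>x. x \<in> V \<Longrightarrow> u x = w x) \<Longrightarrow> grad V c u = grad V c w"
  unfolding grad_def by (rule arg_cong[of _ _ Abs_ell2]) auto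

lemma inner_grad:
  assumes "u \<in> dom_energy V c" "w \<in> dom_energy V c"
  shows "inner (grad V c u) (grad V c w) = energy V c u w"
proof -
  have "inner (grad V c u) (grad V c w) = (\<Sum>\<^sub>\<infinity>p. coord (grad V c u) p * coord (grad V c w) p)"
    by (rule inner_ell2.rep_eq)
  also have "\<dots> = (\<Sum>\<^sub>\<infinity>p\<in>V \<times> V. (case p of (x, y) \<Rightarrow> c x y * (u x - u y) * (w x - w y)) * (1 / 2))"
    by (rule infsum_cong_neutral) (auto simp: coord_grad_mult grad_outside assms)
  also have "\<dots> = energy V c u w"
    unfolding energy_def by (subst infsum_cmult_left') simp
  finally show ?thesis .
qed

lemma adjacent_diff:
  assumes "u \<in> dom_energy V c" "x \<in> V" "y \<in> V" "0 < c x y"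
  shows "u x - u y = coord (grad V c u) (x, y) / sqrt (c x y / 2)"
  using assms by (simp add: grad_coord)

lemma grad_eq_iff:
  assumes "u \<in> dom_energy V c" "w \<in> dom_energy V c"
  shows "grad V c u = grad V c w \<longleftrightarrow> (\<exists>a. \<forall>x\<in>V. u x - w x = a)"
proof
  assume eq: "grad V c u = grad V c w"
  have *: "u x - w x = u y - w y" if "x \<in> V" "y \<in> V" for x y
    using path[OF that]
  proof induction
    case (step a b)
    then have "u a - u b = w a - w b"
      using adjacent_diff[OF assms(1), of a b] adjacent_diff[OF assms(2), of a b] eq by simp
    with step.IH show ?case
      by simp
  qed simp
  show "\<exists>a. \<forall>x\<in>V. u x - w x = a"
  proof (cases "V = {}")
    case False
    then obtain z where "z \<in> V"
      by blast
    with * show ?thesis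
      by (intro exI[of _ "u z - w z"]) blast
  qed simp
next
  assume "\<exists>a. \<forall>x\<in>V. u x - w x = a"
  then obtain a where a: "\<And>x. x \<in> V \<Longrightarrow> u x - w x = a"
    by blast
  have "u x - u y = w x - w y" if "x \<in> V" "y \<in> V" for x y
    using a[OF that(1)] a[OF that(2)] by simp
  then show "grad V c u = grad V c w"
    unfolding grad_def by (intro arg_cong[of _ _ Abs_ell2] ext) (auto split: prod.split)
qed

text \<open>
  The functions \<open>u n\<close> only need to describe a given coordinate of \<open>g n\<close> for large \<open>n\<close>.  This covers
  at once the closedness of the set of gradients and the limit of gradients along an exhaustion.
  Following a path from a fixed vertex \<open>z\<close>, the differences \<open>u n x - u n z\<close> converge for every \<open>x\<close>, and
  their limit is a potential for \<open>l\<close>.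
\<close>
lemma limit_of_partial_gradients:
  assumes g: "g \<longlonglongrightarrow> l"
    and gu: "\<And>x y. x \<in> V \<Longrightarrow> y \<in> V \<Longrightarrow>
      eventually (\<lambda>n. coord (g n) (x, y) = sqrt (c x y / 2) * (u n x - u n y)) sequentially"
    and outside: "\<And>n p. p \<notin> V \<times> V \<Longrightarrow> coord (g n) p = 0"
  shows "l \<in> grads V c"
proof (cases "V = {}")
  case True
  with outside have "g n = 0" for n
    by (simp add: fun_eq_iff flip: coord_inject)
  then have "g = (\<lambda>_. 0)"
    by (rule ext)
  with g have "l = grad V c (\<lambda>_. 0)"
    by (simp add: LIMSEQ_const_iff grad_zero)
  with dom_energy_zero show ?thesis
    unfolding grads_def by blast
next
  case False
  then obtain z where z: "z \<in> V"
    by blast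
  have conv: "convergent (\<lambda>n. u n x - u n z)" if "x \<in> V" for x
    using path[OF z that]
  proof induction
    case (step a b)
    have "(\<lambda>n. u n a - u n z - coord (g n) (a, b) / sqrt (c a b / 2))
        \<longlonglongrightarrow> lim (\<lambda>n. u n a - u n z) - coord l (a, b) / sqrt (c a b / 2)"
      by (intro tendsto_diff tendsto_divide tendsto_const tendsto_coord g)
        (use step in \<open>simp_all add: convergent_LIMSEQ_iff\<close>)
    moreover have "eventually (\<lambda>n. u n a - u n z - coord (g n) (a, b) / sqrt (c a b / 2) = u n b - u n z) sequentially"
    proof -
      have "eventually (\<lambda>n. coord (g n) (a, b) = sqrt (c a b / 2) * (u n a - u n b)) sequentially"
        using step by (intro gu) auto
      then show ?thesis
        by eventually_elim (use step in simp)
    qed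
    ultimately show ?case
      by (rule convergentI[OF Lim_transform_eventually])
  qed (simp add: convergent_const)
  define w where "w x = lim (\<lambda>n. u n x - u n z)" for x
  have w: "(\<lambda>n. u n x - u n z) \<longlonglongrightarrow> w x" if "x \<in> V" for x
    using conv[OF that] unfolding w_def convergent_LIMSEQ_iff .
  have inside: "coord l (x, y) = sqrt (c x y / 2) * (w x - w y)" if "x \<in> V" "y \<in> V" for x y
  proof (rule LIMSEQ_unique)
    show "(\<lambda>n. coord (g n) (x, y)) \<longlonglongrightarrow> coord l (x, y)"
      by (rule tendsto_coord[OF g])
    have "(\<lambda>n. sqrt (c x y / 2) * ((u n x - u n z) - (u n y - u n z)))
        \<longlonglongrightarrow> sqrt (c x y / 2) * (w x - w y)"
      by (intro tendsto_intros w that)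
    then show "(\<lambda>n. coord (g n) (x, y)) \<longlonglongrightarrow> sqrt (c x y / 2) * (w x - w y)"
      by (rule Lim_transform_eventually) (use gu[OF that] in \<open>auto elim: eventually_mono\<close>)
  qed
  have "coord l p = 0" if "p \<notin> V \<times> V" for p
    using tendsto_coord[OF g, of p] outside[OF that] by (simp add: LIMSEQ_const_iff)
  with gradI[of l w] inside show ?thesis
    unfolding grads_def by (metis imageI)
qed

lemma grads_closed: "closed (grads V c)"
  unfolding closed_sequential_limits
proof (intro allI impI)
  fix g l
  assume "(\<forall>n. g n \<in> grads V c) \<and> g \<longlonglongrightarrow> l"
  then obtain u where u: "\<And>n. u n \<in> dom_energy V c" "g = (\<lambda>n. grad V c (u n))" "g \<longlonglongrightarrow> l"
    unfolding grads_def image_iff by metis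
  show "l \<in> grads V c"
  proof (rule limit_of_partial_gradients[OF u(3)])
    show "eventually (\<lambda>n. coord (g n) (x, y) = sqrt (c x y / 2) * (u n x - u n y)) sequentially"
      if "x \<in> V" "y \<in> V" for x y
      using that by (simp add: u grad_coord)
    show "coord (g n) p = 0" if "p \<notin> V \<times> V" for n p
      using that by (simp add: u grad_outside)
  qed
qed

lemma grads_subspace: "subspace (grads V c)"
proof (rule subspaceI)
  show "0 \<in> grads V c"
    unfolding grads_def using dom_energy_zero grad_zero by (metis imageI)
  show "x + y \<in> grads V c" if "x \<in> grads V c" "y \<in> grads V c" for x y
    using that unfolding grads_def by (auto simp: grad_add[symmetric] intro!: imageI dom_energy_add)
  show "r *\<^sub>R x \<in> grads V c" if "x \<in> grads V c" for r x
    using that unfolding grads_def by (auto simp: grad_scale[symmetric] intro!: imageI dom_energy_scale)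
qed


section \<open>Dipoles\<close>

text \<open>
  On one edge the drop is a multiple of a coordinate of the gradient; along a path these add up.
\<close>
lemma voltage_drop_functional:
  assumes "x \<in> V" "y \<in> V"
  obtains w where "\<And>u. u \<in> dom_energy V c \<Longrightarrow> inner w (grad V c u) = u y - u x"
proof -
  have "\<exists>w. \<forall>u\<in>dom_energy V c. inner w (grad V c u) = u y - u x"
    using path[OF assms]
  proof induction
    case base
    show ?case
      by (rule exI[of _ 0]) simp
  next
    case (step a b)
    then obtain w where w: "\<And>u. u \<in> dom_energy V c \<Longrightarrow> inner w (grad V c u) = u a - u x"
      by blast
    obtain e where "coord e = (\<lambda>p. if p = (a, b) then 1 else 0)"
      by (rule ell2_of_bounded_sums[of "\<lambda>p. if p = (a, b) then 1 else 0" 1])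
        (auto simp: if_distrib[of "\<lambda>t. t\<^sup>2"] sum.delta cong: if_cong)
    then have e: "inner e g = coord g (a, b)" for g
    proof -
      have "((\<lambda>p. coord e p * coord g p) has_sum coord g (a, b)) UNIV"
        by (rule has_sum_finite_neutralI[of "{(a, b)}"]) (simp_all add: \<open>coord e = _\<close>)
      then show ?thesis
        by (simp add: inner_ell2.rep_eq infsumI)
    qed
    have "inner (w - (1 / sqrt (c a b / 2)) *\<^sub>R e) (grad V c u) = u b - u x"
      if "u \<in> dom_energy V c" for u
      using w[OF that] adjacent_diff[OF that, of a b] step by (simp add: inner_diff_left e)
    then show ?case
      by blast
  qed
  with that show thesis
    by blast
qed

text \<open>
  The vector representing the drop need not be a gradient, but its projection to the gradients has
  the same inner products with them.
\<close>
lemma dipole_exists: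
  assumes "x \<in> V" "y \<in> V"
  obtains \<phi> where "\<phi> \<in> dom_energy V c"
    "\<And>u. u \<in> dom_energy V c \<Longrightarrow> inner (grad V c \<phi>) (grad V c u) = u y - u x"
proof -
  obtain w where w: "\<And>u. u \<in> dom_energy V c \<Longrightarrow> inner w (grad V c u) = u y - u x"
    using voltage_drop_functional[OF assms] by blast
  note E = grads_subspace grads_closed
  obtain \<phi> where \<phi>: "\<phi> \<in> dom_energy V c" "orth_proj (grads V c) w = grad V c \<phi>"
    using orth_proj_in[OF E, of w] unfolding grads_def by blast
  have "inner (grad V c \<phi>) (grad V c u) = u y - u x" if "u \<in> dom_energy V c" for u
    using orth_proj_inner[OF E, of "grad V c u" w] w[OF that] \<phi>(2) that by (simp add: grads_def)
  with \<phi>(1) show thesis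
    by (rule that)
qed


section \<open>The Gauss--Green formula\<close>

text \<open>
  Sums over all edges of expressions in \<open>\<delta>\<^sub>z\<close> reduce to the star of \<open>z\<close>; the two statements treat
  the edges leaving and entering \<open>z\<close>.
\<close>
lemma star_has_sum:
  assumes "(k has_sum s) V" "z \<in> V"
  shows "((\<lambda>(a, b). if a = z then k b else 0) has_sum s) (V \<times> V)"
    and "((\<lambda>(a, b). if b = z then k a else 0) has_sum s) (V \<times> V)"
proof -
  have "((\<lambda>(a, b). if a = z then k b else 0) has_sum s) (Pair z ` V)"
    using assms by (subst has_sum_reindex) (auto simp: o_def inj_on_def)
  also have "?this \<longleftrightarrow> ((\<lambda>(a, b). if a = z then k b else 0) has_sum s) (V \<times> V)"
    by (rule has_sum_cong_neutral) (use assms(2) in auto)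
  finally show 1: "((\<lambda>(a, b). if a = z then k b else 0) has_sum s) (V \<times> V)" .
  have "((\<lambda>(a, b). if b = z then k a else 0) has_sum s) (prod.swap ` (V \<times> V))"
    using 1 by (subst has_sum_reindex) (auto simp: o_def case_prod_unfold cong: if_cong)
  then show "((\<lambda>(a, b). if b = z then k a else 0) has_sum s) (V \<times> V)"
    by (simp only: product_swap)
qed

lemma delta_dom_energy:
  assumes z: "z \<in> V"
  shows "indicator {z} \<in> dom_energy V c"
proof -
  obtain s where s: "(c z has_sum s) V"
    using cond_summable[OF z] by (auto simp: summable_on_def)
  have "((\<lambda>p. (case p of (a, b) \<Rightarrow> if a = z then c z b else 0) +
      (case p of (a, b) \<Rightarrow> if b = z then c z a else 0)) has_sum (s + s)) (V \<times> V)"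
    by (intro has_sum_add star_has_sum s z)
  also have "?this \<longleftrightarrow> ((\<lambda>(a, b). c a b * (indicator {z} a - indicator {z} b)\<^sup>2) has_sum (s + s)) (V \<times> V)"
    by (rule has_sum_cong) (auto simp: indicator_def cond_refl z cond_commute[OF z])
  finally show ?thesis
    by (auto simp: dom_energy_def summable_on_def)
qed

text \<open>
  The term of the energy at \<open>(a, b)\<close> is the sum of a term that lives on \<open>a = z\<close> and one that lives
  on \<open>b = z\<close>, and each of the two contributes half the Laplacian at \<open>z\<close>.
\<close>
lemma inner_grad_delta:
  assumes u: "u \<in> dom_energy V c" and z: "z \<in> V"
  shows "inner (grad V c u) (grad V c (indicator {z})) = laplacian V c u z"
proof -
  note \<delta> = delta_dom_energy[OF z]
  define f where "f p = coord (grad V c u) p * coord (grad V c (indicator {z})) p" for p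
  have f: "f summable_on A" for A
    unfolding f_def by (rule summable_on_subset_banach[OF square_summable_mult[OF coord_square_summable coord_square_summable]]) simp
  have f_eq: "f (a, b) = c a b / 2 * (u a - u b) * (indicator {z} a - indicator {z} b)" if "a \<in> V" "b \<in> V" for a b
    using that u \<delta> by (simp add: f_def coord_grad_mult)
  have "(f \<circ> Pair z) summable_on V"
    using f[of "Pair z ` V"] by (subst (asm) summable_on_reindex) (auto simp: inj_on_def)
  then have "(\<lambda>b. 2 * (f \<circ> Pair z) b) summable_on V"
    by (rule summable_on_cmult_right)
  also have "?this \<longleftrightarrow> (\<lambda>b. c z b * (u z - u b)) summable_on V"
    by (rule summable_on_cong) (auto simp: f_eq z indicator_def)
  finally have "(\<lambda>b. c z b * (u z - u b)) summable_on V" .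
  then have "((\<lambda>b. c z b * (u z - u b)) has_sum laplacian V c u z) V"
    using laplacian_has_sum_iff[OF z] by blast
  then have half: "((\<lambda>b. 1 / 2 * (c z b * (u z - u b))) has_sum (1 / 2 * laplacian V c u z)) V"
    by (rule has_sum_cmult_right)
  have "((\<lambda>p. (case p of (a, b) \<Rightarrow> if a = z then 1 / 2 * (c z b * (u z - u b)) else 0) +
      (case p of (a, b) \<Rightarrow> if b = z then 1 / 2 * (c z a * (u z - u a)) else 0)) has_sum
      (1 / 2 * laplacian V c u z + 1 / 2 * laplacian V c u z)) (V \<times> V)"
    by (intro has_sum_add star_has_sum half z)
  also have "?this \<longleftrightarrow> (f has_sum (1 / 2 * laplacian V c u z + 1 / 2 * laplacian V c u z)) UNIV"
  proof (rule has_sum_cong_neutral)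
    fix p
    assume "p \<in> V \<times> V \<inter> UNIV"
    then obtain a b where p: "p = (a, b)" "a \<in> V" "b \<in> V"
      by auto
    then show "(case p of (a, b) \<Rightarrow> if a = z then 1 / 2 * (c z b * (u z - u b)) else 0) +
      (case p of (a, b) \<Rightarrow> if b = z then 1 / 2 * (c z a * (u z - u a)) else 0) = f p"
      using cond_commute[OF z, of a] by (auto simp: f_eq indicator_def algebra_simps)
  qed (auto simp: f_def grad_outside u)
  finally show "inner (grad V c u) (grad V c (indicator {z})) = laplacian V c u z"
    by (simp add: inner_ell2.rep_eq f_def[symmetric] infsumI)
qed

lemma inner_grad_finite_support:
  assumes u: "u \<in> dom_energy V c" and S: "finite S" "S \<subseteq> V" and w: "\<And>x. x \<in> V - S \<Longrightarrow> w x = 0"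
  shows "w \<in> dom_energy V c" "grad V c w = (\<Sum>z\<in>S. w z *\<^sub>R grad V c (indicator {z}))"
    "inner (grad V c u) (grad V c w) = (\<Sum>z\<in>S. w z * laplacian V c u z)"
proof -
  let ?w = "\<lambda>x. \<Sum>z\<in>S. w z * indicator {z} x"
  have \<delta>: "\<And>z. z \<in> S \<Longrightarrow> indicator {z} \<in> dom_energy V c"
    using S(2) delta_dom_energy by blast
  have w_eq: "w x = ?w x" if "x \<in> V" for x
    using S(1) w[of x] that by (cases "x \<in> S") (auto simp: indicator_def sum.delta if_distrib cong: if_cong)
  have "?w \<in> dom_energy V c \<longleftrightarrow> w \<in> dom_energy V c"
    unfolding dom_energy_def mem_Collect_eq by (rule summable_on_cong) (auto simp: w_eq)
  with dom_energy_sum[OF S(1) \<delta>] show "w \<in> dom_energy V c"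
    by simp
  have "grad V c w = grad V c ?w"
    by (rule grad_cong) (rule w_eq)
  with grad_sum[OF S(1) \<delta>] show gr: "grad V c w = (\<Sum>z\<in>S. w z *\<^sub>R grad V c (indicator {z}))"
    by simp
  show "inner (grad V c u) (grad V c w) = (\<Sum>z\<in>S. w z * laplacian V c u z)"
    unfolding gr inner_sum_right
    by (rule sum.cong) (use S(2) u in \<open>auto simp: inner_grad_delta\<close>)
qed


section \<open>The energy space\<close>

text \<open>
  The isometry from the energy space onto the set of gradients; all operations defined on classes
  through representatives are transported along it.
\<close>
definition class_grad :: "('v \<Rightarrow> real) set \<Rightarrow> ('v \<times> 'v) ell2" where
  "class_grad A = grad V c (erep A)"

lemma mem_eclass_iff:
  "u \<in> dom_energy V c \<Longrightarrow> w \<in> eclass V c u \<longleftrightarrow> w \<in> dom_energy V c \<and> grad V c w = grad V c u"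
  using grad_eq_iff[of u w] by (auto simp: eclass_def const_rel_def)

lemma erep_eclass:
  assumes "u \<in> dom_energy V c"
  shows "erep (eclass V c u) \<in> dom_energy V c" "class_grad (eclass V c u) = grad V c u"
proof -
  have "u \<in> eclass V c u"
    using assms by (simp add: mem_eclass_iff)
  then have "erep (eclass V c u) \<in> eclass V c u"
    unfolding erep_def by (rule someI[of "\<lambda>w. w \<in> eclass V c u"])
  with assms show "erep (eclass V c u) \<in> dom_energy V c" "class_grad (eclass V c u) = grad V c u"
    by (simp_all add: mem_eclass_iff class_grad_def)
qed

lemma energy_space_eq: "energy_space V c = eclass V c ` dom_energy V c"
  by (auto simp: energy_space_def quotient_def eclass_def)

lemma erep_dom_energy: "A \<in> energy_space V c \<Longrightarrow> erep A \<in> dom_energy V c"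
  unfolding energy_space_eq using erep_eclass(1) by blast

lemma bij_class_grad: "bij_betw class_grad (energy_space V c) (grads V c)"
  unfolding bij_betw_def
proof
  show "inj_on class_grad (energy_space V c)"
  proof (rule inj_onI)
    fix A B
    assume "A \<in> energy_space V c" "B \<in> energy_space V c" and eq: "class_grad A = class_grad B"
    then obtain u w where "A = eclass V c u" "u \<in> dom_energy V c" "B = eclass V c w" "w \<in> dom_energy V c"
      by (auto simp: energy_space_eq)
    with eq show "A = B"
      by (auto simp: mem_eclass_iff erep_eclass)
  qed
  show "class_grad ` energy_space V c = grads V c"
    by (simp add: energy_space_eq grads_def image_image erep_eclass cong: image_cong)
qed

lemma class_grad_inj:
  "A \<in> energy_space V c \<Longrightarrow> B \<in> energy_space V c \<Longrightarrow> class_grad A = class_grad B \<longleftrightarrow> A = B"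
  using bij_class_grad by (auto simp: bij_betw_def dest: inj_onD)

lemma class_grad_in: "A \<in> energy_space V c \<Longrightarrow> class_grad A \<in> grads V c"
  using bij_class_grad by (auto simp: bij_betw_def)

lemma class_grad_surj:
  assumes "g \<in> grads V c"
  obtains A where "A \<in> energy_space V c" "class_grad A = g"
  using assms bij_class_grad by (metis bij_betw_def imageE)

lemma
  assumes "A \<in> energy_space V c" "B \<in> energy_space V c"
  shows eadd_in: "eadd V c A B \<in> energy_space V c"
    and class_grad_eadd: "class_grad (eadd V c A B) = class_grad A + class_grad B"
    and ediff_in: "ediff V c A B \<in> energy_space V c"
    and class_grad_ediff: "class_grad (ediff V c A B) = class_grad A - class_grad B"
    and einner_eq: "einner V c A B = inner (class_grad A) (class_grad B)"
  using erep_dom_energy[OF assms(1)] erep_dom_energy[OF assms(2)]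
  by (auto simp: eadd_def ediff_def einner_def erep_eclass class_grad_def[of A] class_grad_def[of B]
      energy_space_eq grad_add grad_diff dom_energy_add dom_energy_diff inner_grad)

lemma
  assumes "A \<in> energy_space V c"
  shows escale_in: "escale V c r A \<in> energy_space V c"
    and class_grad_escale: "class_grad (escale V c r A) = r *\<^sub>R class_grad A"
  using erep_dom_energy[OF assms]
  by (auto simp: escale_def enorm_def erep_eclass class_grad_def[of A] energy_space_eq
      grad_scale dom_energy_scale)

lemma enorm_eq: "A \<in> energy_space V c \<Longrightarrow> enorm V c A = norm (class_grad A)"
  by (simp add: enorm_def einner_eq norm_eq_sqrt_inner)

lemma class_dist: "A \<in> energy_space V c \<Longrightarrow> B \<in> energy_space V c \<Longrightarrow>
    enorm V c (ediff V c A B) = dist (class_grad A) (class_grad B)"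
  by (simp add: enorm_eq ediff_in class_grad_ediff dist_norm)

lemma dipole:
  assumes "x0 \<in> V" "x \<in> V"
  shows dipole_in: "dipole V c x0 x \<in> energy_space V c"
    and inner_dipole: "u \<in> dom_energy V c \<Longrightarrow> inner (class_grad (dipole V c x0 x)) (grad V c u) = u x - u x0"
proof -
  obtain \<phi> where \<phi>: "\<phi> \<in> dom_energy V c"
    "\<And>u. u \<in> dom_energy V c \<Longrightarrow> inner (grad V c \<phi>) (grad V c u) = u x - u x0"
    using dipole_exists[OF assms] by blast
  have A: "eclass V c \<phi> \<in> energy_space V c" "class_grad (eclass V c \<phi>) = grad V c \<phi>"
    using \<phi>(1) by (simp_all add: energy_space_eq erep_eclass)
  have eq: "dipole V c x0 x = eclass V c \<phi>"
    unfolding dipole_def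
  proof (rule the_equality, intro conjI ballI A(1))
    fix B
    assume "B \<in> energy_space V c"
    then show "einner V c (eclass V c \<phi>) B = erep B x - erep B x0"
      using \<phi>(2)[OF erep_dom_energy] by (simp add: einner_eq A class_grad_def[of B])
  next
    fix A'
    assume A': "A' \<in> energy_space V c \<and> (\<forall>B\<in>energy_space V c. einner V c A' B = erep B x - erep B x0)"
    have "class_grad A' = class_grad (eclass V c \<phi>)"
    proof (rule eq_if_inner_eq[OF grads_subspace])
      fix s
      assume "s \<in> grads V c"
      then obtain B where B: "B \<in> energy_space V c" "class_grad B = s"
        by (rule class_grad_surj)
      then have "inner (class_grad A') s = erep B x - erep B x0"
        using A' einner_eq by metis
      also have "\<dots> = inner (class_grad (eclass V c \<phi>)) s"
        using \<phi>(2)[OF erep_dom_energy[OF B(1)]] B(2) by (simp add: A class_grad_def[of B])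
      finally show "inner (class_grad A') s = inner (class_grad (eclass V c \<phi>)) s" .
    qed (use A' class_grad_in[OF A(1)] class_grad_in[of A'] in simp_all)
    then show "A' = eclass V c \<phi>"
      using class_grad_inj[of A' "eclass V c \<phi>"] A' A by blast
  qed
  show "dipole V c x0 x \<in> energy_space V c"
    using A(1) by (simp add: eq)
  show "u \<in> dom_energy V c \<Longrightarrow> inner (class_grad (dipole V c x0 x)) (grad V c u) = u x - u x0"
    using \<phi>(2) by (simp add: eq A)
qed

lemma inner_dipole_diff:
  assumes "x0 \<in> V" "x \<in> V" "y \<in> V" "u \<in> dom_energy V c"
  shows "inner (class_grad (dipole V c x0 x) - class_grad (dipole V c x0 y)) (grad V c u) = u x - u y"
  using assms by (simp add: inner_diff_left inner_dipole)

lemma dipole_base: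
  assumes "x0 \<in> V"
  shows "class_grad (dipole V c x0 x0) = 0"
proof -
  have "class_grad (dipole V c x0 x0) \<in> grads V c"
    using assms by (intro class_grad_in dipole_in)
  then obtain u where "u \<in> dom_energy V c" "class_grad (dipole V c x0 x0) = grad V c u"
    unfolding grads_def by blast
  then show ?thesis
    using inner_dipole[OF assms assms, of u] by simp
qed

text \<open>
  Orthogonality to the dipoles says that a potential of \<open>w\<close> is constant.
\<close>
lemma dipoles_total:
  assumes x0: "x0 \<in> V" and w: "w \<in> grads V c"
    and orth: "\<And>x. x \<in> V \<Longrightarrow> inner w (class_grad (dipole V c x0 x)) = 0"
  shows "w = 0"
proof -
  obtain u where u: "u \<in> dom_energy V c" "w = grad V c u"
    using w unfolding grads_def by blast
  have "u x - u x0 = 0" if "x \<in> V" for x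
    using orth[OF that] inner_dipole[OF x0 that u(1)] by (simp add: u(2) inner_commute)
  then have "\<forall>x\<in>V. u x - 0 = u x0"
    by simp
  then have "grad V c u = grad V c (\<lambda>_. 0)"
    using grad_eq_iff[OF u(1) dom_energy_zero] by blast
  with u(2) show ?thesis
    by (simp add: grad_zero)
qed


section \<open>The subspace Fin\<close>

definition delta :: "'v \<Rightarrow> ('v \<times> 'v) ell2" where
  "delta z = grad V c (indicator {z})"

text \<open>
  The image of \<open>Fin\<close> under the isometry, see \<open>class_grad_Fin\<close> below.
\<close>
definition fins :: "('v \<times> 'v) ell2 set" where
  "fins = closure (span (delta ` V))"

lemma fins: "subspace fins" "closed fins"
  by (simp_all add: fins_def subspace_closure)

lemma fins_subset: "fins \<subseteq> grads V c"
proof -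
  have "delta ` V \<subseteq> grads V c"
    by (auto simp: delta_def grads_def delta_dom_energy)
  then show ?thesis
    unfolding fins_def using grads_subspace grads_closed by (simp add: closure_minimal span_minimal)
qed

lemma class_grad_delta_span:
  "delta_span V c \<subseteq> energy_space V c" "class_grad ` delta_span V c = span (delta ` V)"
proof -
  let ?u = "\<lambda>S a z. \<Sum>x\<in>S. a x * indicator {x} z :: real"
  have u: "?u S a \<in> dom_energy V c" "grad V c (?u S a) = (\<Sum>x\<in>S. a x *\<^sub>R delta x)"
    if "finite S" "S \<subseteq> V" for S a
    using that dom_energy_sum[of S "\<lambda>x. indicator {x}" a] grad_sum[of S "\<lambda>x. indicator {x}" a]
    by (auto simp: delta_dom_energy delta_def subset_iff)
  then show "delta_span V c \<subseteq> energy_space V c"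
    by (auto simp: delta_span_def energy_space_eq)
  have cg: "class_grad (eclass V c (?u S a)) = (\<Sum>x\<in>S. a x *\<^sub>R delta x)" if "finite S" "S \<subseteq> V" for S a
    using u[OF that] by (simp add: erep_eclass)
  have "class_grad ` delta_span V c = {\<Sum>x\<in>S. a x *\<^sub>R delta x | S a. finite S \<and> S \<subseteq> V}"
  proof (intro equalityI subsetI)
    fix g
    assume "g \<in> class_grad ` delta_span V c"
    then obtain S a where "finite S" "S \<subseteq> V" "g = class_grad (eclass V c (?u S a))"
      unfolding delta_span_def by blast
    then show "g \<in> {\<Sum>x\<in>S. a x *\<^sub>R delta x | S a. finite S \<and> S \<subseteq> V}"
      using cg by blast
  next
    fix g
    assume "g \<in> {\<Sum>x\<in>S. a x *\<^sub>R delta x | S a. finite S \<and> S \<subseteq> V}"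
    then obtain S a where S: "finite S" "S \<subseteq> V" and g: "g = (\<Sum>x\<in>S. a x *\<^sub>R delta x)"
      by blast
    have "eclass V c (?u S a) \<in> delta_span V c"
      using S unfolding delta_span_def by blast
    then show "g \<in> class_grad ` delta_span V c"
      unfolding g cg[OF S, symmetric] by (rule imageI)
  qed
  also have "\<dots> = span (delta ` V)"
  proof (intro equalityI subsetI)
    fix g
    assume "g \<in> {\<Sum>x\<in>S. a x *\<^sub>R delta x | S a. finite S \<and> S \<subseteq> V}"
    then show "g \<in> span (delta ` V)"
      by (auto intro!: span_sum span_scale intro: span_base)
  next
    fix g
    assume "g \<in> span (delta ` V)"
    then show "g \<in> {\<Sum>x\<in>S. a x *\<^sub>R delta x | S a. finite S \<and> S \<subseteq> V}"
    proof (induction rule: span_induct_alt)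
      case base
      show ?case
        by (intro CollectI exI[of _ "{}"]) simp
    next
      case (step r h g)
      then obtain x S a where x: "h = delta x" "x \<in> V" and
        S: "g = (\<Sum>x\<in>S. a x *\<^sub>R delta x)" "finite S" "S \<subseteq> V"
        by auto
      \<comment> \<open>the new generator may already occur in the sum, so its coefficient is added to the old one\<close>
  define a' where "a' y = (if y = x then r else 0) + (if y \<in> S then a y else 0)" for y
      have "(\<Sum>y\<in>insert x S. a' y *\<^sub>R delta y)
          = (\<Sum>y\<in>insert x S. if y = x then r *\<^sub>R delta y else 0) + (\<Sum>y\<in>insert x S. if y \<in> S then a y *\<^sub>R delta y else 0)"
        unfolding sum.distrib[symmetric] by (rule sum.cong) (auto simp: a'_def scaleR_add_left)
      also have "(\<Sum>y\<in>insert x S. if y = x then r *\<^sub>R delta y else 0) = r *\<^sub>R delta x"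
        using S(2) by (simp add: sum.delta)
      also have "(\<Sum>y\<in>insert x S. if y \<in> S then a y *\<^sub>R delta y else 0) = g"
        unfolding S(1) by (rule sum.mono_neutral_cong_right) (use S(2) in auto)
      finally show ?case
        using S x by (intro CollectI exI[of _ "insert x S"] exI[of _ a']) auto
    qed
  qed
  finally show "class_grad ` delta_span V c = span (delta ` V)" .
qed

text \<open>
  The first two axioms concern arbitrary sets, including those that are not elements of the energy
  space.  A difference of representatives with infinite energy has the empty class, whatever the
  order of the two terms.
\<close>
lemma energy_metric: "Metric_space (energy_space V c) (\<lambda>A B. enorm V c (ediff V c A B))"
proof
  show "0 \<le> enorm V c (ediff V c A B)" for A B
  proof -
    have "0 \<le> energy V c u u" for u
      unfolding energy_def using cond_nonneg
      by (auto intro!: divide_nonneg_pos infsum_nonneg simp: mult.assoc)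
    then show ?thesis
      by (simp add: enorm_def einner_def)
  qed
  show "enorm V c (ediff V c A B) = enorm V c (ediff V c B A)" for A B
  proof (cases "(\<lambda>x. erep A x - erep B x) \<in> dom_energy V c")
    case True
    have "(\<lambda>x. erep B x - erep A x) = (\<lambda>x. -1 * (erep A x - erep B x))"
      by auto
    then have "(\<lambda>x. erep B x - erep A x) \<in> dom_energy V c"
      "grad V c (\<lambda>x. erep B x - erep A x) = -1 *\<^sub>R grad V c (\<lambda>x. erep A x - erep B x)"
      using dom_energy_scale[OF True, of "-1"] grad_scale[OF True, of "-1"] by simp_all
    with True show ?thesis
      by (simp add: ediff_def enorm_eq energy_space_eq erep_eclass)
  next
    case False
    have "(\<lambda>x. erep B x - erep A x) \<notin> dom_energy V c"
      using False dom_energy_scale[of "\<lambda>x. erep B x - erep A x" "-1"] by auto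
    with False show ?thesis
      by (simp add: ediff_def eclass_def const_rel_def Image_def)
  qed
  show "enorm V c (ediff V c A B) = 0 \<longleftrightarrow> A = B"
    if "A \<in> energy_space V c" "B \<in> energy_space V c" for A B
    using that by (simp add: class_dist class_grad_inj)
  show "enorm V c (ediff V c A C) \<le> enorm V c (ediff V c A B) + enorm V c (ediff V c B C)"
    if "A \<in> energy_space V c" "B \<in> energy_space V c" "C \<in> energy_space V c" for A B C
    using that by (simp add: class_dist dist_triangle)
qed

lemma mem_Fin_iff: "A \<in> Fin V c \<longleftrightarrow> A \<in> energy_space V c \<and> class_grad A \<in> fins"
proof -
  interpret E: Metric_space "energy_space V c" "\<lambda>A B. enorm V c (ediff V c A B)"
    by (rule energy_metric)
  have "B \<in> E.mball A r \<longleftrightarrow> dist (class_grad B) (class_grad A) < r"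
    if "A \<in> energy_space V c" "B \<in> delta_span V c" for B r
    using that class_grad_delta_span(1) by (auto simp: E.in_mball class_dist dist_commute)
  then have "A \<in> Fin V c \<longleftrightarrow> A \<in> energy_space V c \<and>
      (\<forall>r>0. \<exists>B\<in>delta_span V c. dist (class_grad B) (class_grad A) < r)"
    unfolding Fin_def E.metric_closure_of by auto
  also have "(\<forall>r>0. \<exists>B\<in>delta_span V c. dist (class_grad B) (class_grad A) < r) \<longleftrightarrow> class_grad A \<in> fins"
    unfolding fins_def closure_approachable class_grad_delta_span(2)[symmetric] by simp
  finally show ?thesis .
qed

lemma class_grad_Fin: "class_grad ` Fin V c = fins"
proof (intro equalityI subsetI)
  fix g
  assume "g \<in> fins"
  then obtain A where "A \<in> energy_space V c" "class_grad A = g"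
    using fins_subset class_grad_surj by blast
  with \<open>g \<in> fins\<close> show "g \<in> class_grad ` Fin V c"
    using mem_Fin_iff by blast
qed (auto simp: mem_Fin_iff)

lemma proj_Fin:
  assumes A: "A \<in> energy_space V c"
  shows proj_Fin_in: "proj_Fin V c A \<in> Fin V c"
    and class_grad_proj_Fin: "class_grad (proj_Fin V c A) = orth_proj fins (class_grad A)"
proof -
  obtain P where P: "P \<in> Fin V c" "class_grad P = orth_proj fins (class_grad A)"
    using orth_proj_in[OF fins] class_grad_Fin by (metis imageE)
  have inner: "einner V c (ediff V c A Q) B = inner (class_grad A) (class_grad B) - inner (class_grad Q) (class_grad B)"
    if "Q \<in> Fin V c" "B \<in> Fin V c" for Q B
    using that A by (simp add: mem_Fin_iff einner_eq ediff_in class_grad_ediff inner_diff_left)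
  have "proj_Fin V c A = P"
    unfolding proj_Fin_def
  proof (rule the_equality, intro conjI ballI P(1))
    fix B
    assume "B \<in> Fin V c"
    then show "einner V c (ediff V c A P) B = 0"
      using P by (simp add: inner mem_Fin_iff orth_proj_inner[OF fins])
  next
    fix Q
    assume Q: "Q \<in> Fin V c \<and> (\<forall>B\<in>Fin V c. einner V c (ediff V c A Q) B = 0)"
    have "class_grad Q = class_grad P"
    proof (rule eq_if_inner_eq[OF fins(1)])
      fix s
      assume s: "s \<in> fins"
      then obtain B where "B \<in> Fin V c" "s = class_grad B"
        using class_grad_Fin by blast
      then have "inner (class_grad Q) s = inner (class_grad A) s"
        using Q inner by fastforce
      with s show "inner (class_grad Q) s = inner (class_grad P) s"
        by (simp add: P(2) orth_proj_inner[OF fins])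
    qed (use P Q in \<open>auto simp: mem_Fin_iff\<close>)
    then show "Q = P"
      using class_grad_inj[of Q P] P Q by (simp add: mem_Fin_iff)
  qed
  with P show "proj_Fin V c A \<in> Fin V c" "class_grad (proj_Fin V c A) = orth_proj fins (class_grad A)"
    by simp_all
qed


section \<open>Von Neumann embeddings\<close>

text \<open>
  Since the isometry of Gram matrices takes values in the gradients, composing it with the inverse of
  \<open>class_grad\<close> gives the required unitary map.
\<close>
lemma unitary_extension:
  fixes k :: "'v \<Rightarrow> 'k::{real_inner, complete_space}" and b :: "'v \<Rightarrow> ('v \<Rightarrow> real) set"
  assumes x0: "x0 \<in> V" and M: "M \<subseteq> energy_space V c" and bM: "\<And>x. x \<in> V \<Longrightarrow> b x \<in> M"
    and total: "closure (span ((\<lambda>x. class_grad (b x)) ` V)) = class_grad ` M"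
    and base: "class_grad (b x0) = 0"
    and isom: "\<And>x y. x \<in> V \<Longrightarrow> y \<in> V \<Longrightarrow> (norm (k x - k y))\<^sup>2 = (enorm V c (ediff V c (b x) (b y)))\<^sup>2"
    and dense: "closure (span ((\<lambda>x. k x - k x0) ` V)) = UNIV"
  shows "\<exists>U. unitary_iso V c M U \<and> (\<forall>x\<in>V. U (k x - k x0) = b x)"
proof -
  let ?g = "\<lambda>x. class_grad (b x)"
  have dist: "(norm (k x - k y))\<^sup>2 = (norm (?g x - ?g y))\<^sup>2" if "x \<in> V" "y \<in> V" for x y
    using isom[OF that] bM[OF that(1)] bM[OF that(2)] M by (simp add: class_dist subset_iff dist_norm)
  have gram: "inner (k x - k x0) (k y - k x0) = inner (?g x) (?g y)" if "x \<in> V" "y \<in> V" for x y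
  proof -
    \<comment> \<open>polarization\<close>
    have "2 * inner p q = (norm p)\<^sup>2 + (norm q)\<^sup>2 - (norm (p - q))\<^sup>2" for p q :: "'z::real_inner"
      by (simp add: power2_norm_eq_inner inner_diff inner_commute)
    note pol = this[of "k x - k x0" "k y - k x0"] this[of "?g x" "?g y"]
    show ?thesis
      using pol dist[OF that(1) x0] dist[OF that(2) x0] dist[OF that] by (simp add: base)
  qed
  obtain U where U: "linear U" "\<And>p q. inner (U p) (U q) = inner p q"
    "range U = class_grad ` M" "\<And>x. x \<in> V \<Longrightarrow> U (k x - k x0) = ?g x"
    using isometry_of_equal_gram[of V "\<lambda>x. k x - k x0" ?g, OF gram dense] unfolding total by blast
  define W where "W p = the_inv_into M class_grad (U p)" for p
  have inj: "inj_on class_grad M"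
    using bij_class_grad M by (auto simp: bij_betw_def intro: inj_on_subset)
  have W: "W p \<in> M" "class_grad (W p) = U p" for p
  proof -
    have "U p \<in> class_grad ` M"
      using U(3) by blast
    then show "W p \<in> M" "class_grad (W p) = U p"
      unfolding W_def by (auto intro: the_inv_into_into[OF inj] f_the_inv_into_f[OF inj])
  qed
  have WE: "W p \<in> energy_space V c" for p
    using W(1) M by blast
  have W_eq: "W p = A" if "A \<in> energy_space V c" "class_grad A = U p" for p A
    using that class_grad_inj[OF WE, of A p] by (simp add: W)
  have "unitary_iso V c M W"
    unfolding unitary_iso_def
  proof (intro conjI allI)
    show "bij_betw W UNIV M"
      unfolding bij_betw_def
    proof
      show "inj W"
      proof (rule injI)
        fix p q
        assume "W p = W q"
        then have "U (p - q) = 0"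
          using W(2) by (metis U(1) linear_diff right_minus_eq)
        then show "p = q"
          using U(2)[of "p - q" "p - q"] by simp
      qed
      show "range W = M"
      proof (intro equalityI subsetI)
        fix A
        assume A: "A \<in> M"
        then have "class_grad A \<in> range U"
          using U(3) by blast
        then obtain p where "class_grad A = U p"
          by blast
        with A M have "W p = A"
          by (intro W_eq) auto
        then show "A \<in> range W"
          by blast
      qed (use W in auto)
    qed
    show "W (p + q) = eadd V c (W p) (W q)" for p q
      by (rule W_eq) (simp_all add: eadd_in class_grad_eadd WE W(2) linear_add[OF U(1)])
    show "W (r *\<^sub>R p) = escale V c r (W p)" for r p
      by (rule W_eq) (simp_all add: escale_in class_grad_escale WE W(2) linear_scale[OF U(1)])
    show "einner V c (W p) (W q) = inner p q" for p q
      by (simp add: einner_eq WE W(2) U(2))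
  qed
  moreover have "W (k x - k x0) = b x" if "x \<in> V" for x
    using that bM M by (intro W_eq) (auto simp: U(4))
  ultimately show ?thesis
    by blast
qed


section \<open>Finite networks\<close>


lemma finite_dom_energy: "finite V \<Longrightarrow> u \<in> dom_energy V c"
  by (simp add: dom_energy_def)

text \<open>
  The potential of the dipole is a solution, as its pairings with the \<open>\<delta>\<^sub>z\<close> show.
\<close>
lemma finite_potential_exists:
  assumes "finite V" "x \<in> V" "y \<in> V"
  obtains v where "\<And>z. z \<in> V \<Longrightarrow> laplacian V c v z = indicator {x} z - indicator {y} z"
proof -
  obtain v where v: "v \<in> dom_energy V c"
    "\<And>u. u \<in> dom_energy V c \<Longrightarrow> inner (grad V c v) (grad V c u) = u x - u y"
    using dipole_exists[OF assms(3,2)] by blast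
  have "laplacian V c v z = indicator {x} z - indicator {y} z" if "z \<in> V" for z
    using inner_grad_delta[OF v(1) that] v(2)[OF delta_dom_energy[OF that]]
    by (auto simp: indicator_def)
  then show thesis
    by (rule that)
qed

lemma finite_potential_inner:
  assumes V: "finite V" "x \<in> V" "y \<in> V"
    and v: "\<And>z. z \<in> V \<Longrightarrow> laplacian V c v z = indicator {x} z - indicator {y} z"
  shows "inner (grad V c v) (grad V c u) = u x - u y"
proof -
  have "inner (grad V c v) (grad V c u) = (\<Sum>z\<in>V. u z * laplacian V c v z)"
    by (rule inner_grad_finite_support(3)) (use V(1) in \<open>simp_all add: finite_dom_energy\<close>)
  also have "\<dots> = (\<Sum>z\<in>V. (if z = x then u z else 0) - (if z = y then u z else 0))"
    by (rule sum.cong) (auto simp: v indicator_def)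
  also have "\<dots> = u x - u y"
    using V by (simp add: sum_subtractf)
  finally show ?thesis .
qed

lemma fin_resistance_eq:
  assumes V: "finite V" "x \<in> V" "y \<in> V"
    and v: "\<And>z. z \<in> V \<Longrightarrow> laplacian V c v z = indicator {x} z - indicator {y} z"
  shows "fin_resistance V c x y = v x - v y"
  unfolding fin_resistance_def
proof (rule the_equality)
  show "\<exists>v'. (\<forall>z\<in>V. laplacian V c v' z = indicator {x} z - indicator {y} z) \<and> v x - v y = v' x - v' y"
    using v by blast
next
  fix r
  assume "\<exists>v'. (\<forall>z\<in>V. laplacian V c v' z = indicator {x} z - indicator {y} z) \<and> r = v' x - v' y"
  then obtain v' where v': "\<And>z. z \<in> V \<Longrightarrow> laplacian V c v' z = indicator {x} z - indicator {y} z"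
    and r: "r = v' x - v' y"
    by blast
  \<comment> \<open>both drops are the energy pairing of the two potentials\<close>
  show "r = v x - v y"
    using finite_potential_inner[OF V v, of v'] finite_potential_inner[OF V v', of v]
    by (simp add: r inner_commute)
qed


section \<open>Subnetworks and exhaustions\<close>

lemma subnetwork:
  assumes "H \<subseteq> V" "finite H" "connected_net H c"
  shows "network H c"
  using assms network by unfold_locales (auto simp: resistance_network_def subset_iff)

lemma dom_energy_subset:
  assumes "H \<subseteq> V" "u \<in> dom_energy V c"
  shows "u \<in> dom_energy H c"
  using assms summable_on_subset_banach[of _ "V \<times> V" "H \<times> H"] by (auto simp: dom_energy_def)

text \<open>
  A gradient of the subnetwork vanishes outside \<open>H \<times> H\<close>, so it only sees the restriction of \<open>u\<close>.
\<close>
lemma inner_grad_subnetwork: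
  assumes H: "network H c" "H \<subseteq> V" and v: "v \<in> dom_energy H c" and u: "u \<in> dom_energy V c"
  shows "inner (grad H c v) (grad V c u) = inner (grad H c v) (grad H c u)"
proof -
  interpret H: network H c
    by (rule H(1))
  have uH: "u \<in> dom_energy H c"
    by (rule dom_energy_subset[OF H(2) u])
  have "coord (grad H c v) p * coord (grad V c u) p = coord (grad H c v) p * coord (grad H c u) p" for p
  proof (cases "p \<in> H \<times> H")
    case True
    with H(2) show ?thesis
      by (cases p) (auto simp: grad_coord[OF u] H.grad_coord[OF uH])
  qed (simp add: H.grad_outside[OF v])
  then show ?thesis
    unfolding inner_ell2.rep_eq by (rule infsum_cong)
qed

lemma cond_sym_on: "symp (\<lambda>a b. a \<in> H \<and> b \<in> H \<and> 0 < c a b)" if "H \<subseteq> V" for H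
  by (rule sympI) (metis cond_commute subsetD that)

lemma connected_netI:
  assumes "H \<subseteq> V" and hub: "\<And>y. y \<in> H \<Longrightarrow> (\<lambda>a b. a \<in> H \<and> b \<in> H \<and> 0 < c a b)\<^sup>*\<^sup>* x y"
  shows "connected_net H c"
  unfolding connected_net_def
proof (intro ballI)
  fix y z
  assume "y \<in> H" "z \<in> H"
  from sympD[OF symp_rtranclp[OF cond_sym_on[OF assms(1)]] hub[OF \<open>y \<in> H\<close>]] hub[OF \<open>z \<in> H\<close>]
  show "(\<lambda>a b. a \<in> H \<and> b \<in> H \<and> 0 < c a b)\<^sup>*\<^sup>* y z"
    by (rule rtranclp_trans)
qed

lemma finite_connecting_set:
  assumes "x \<in> V" "y \<in> V"
  shows "\<exists>T. finite T \<and> T \<subseteq> V \<and> x \<in> T \<and> y \<in> T \<and> connected_net T c"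
  using path[OF assms]
proof induction
  case base
  show ?case
    using assms by (intro exI[of _ "{x}"]) (auto simp: connected_net_def)
next
  case (step a b)
  then obtain T where T: "finite T" "T \<subseteq> V" "x \<in> T" "a \<in> T" "connected_net T c"
    by blast
  have "connected_net (insert b T) c"
  proof (rule connected_netI)
    show "insert b T \<subseteq> V"
      using T step by auto
    fix y
    assume y: "y \<in> insert b T"
    have T_path: "(\<lambda>a' b'. a' \<in> insert b T \<and> b' \<in> insert b T \<and> 0 < c a' b')\<^sup>*\<^sup>* a z" if "z \<in> T" for z
      using T(4,5) that unfolding connected_net_def
      by (auto intro: rtranclp_mono[THEN predicate2D, rotated])
    show "(\<lambda>a' b'. a' \<in> insert b T \<and> b' \<in> insert b T \<and> 0 < c a' b')\<^sup>*\<^sup>* a y"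
    proof (cases "y = b")
      case True
      with T(4) step show ?thesis
        by auto
    qed (use y T_path in auto)
  qed
  with T step show ?case
    by (intro exI[of _ "insert b T"]) auto
qed

text \<open>
  Summability leaves every vertex with countably many neighbours, and every vertex is reached
  by a finite path.
\<close>
lemma countable_vertices: "countable V"
proof (cases "V = {}")
  case False
  then obtain z where z: "z \<in> V"
    by blast
  define X where "X = {(a, b). a \<in> V \<and> b \<in> V \<and> 0 < c a b}"
  have "countable (X\<^sup>* `` {z})"
  proof (rule countable_rtrancl)
    fix Y :: "'v set"
    assume "countable Y"
    have "X `` Y = (\<Union>a\<in>Y \<inter> V. {b \<in> V. 0 < c a b})"
      by (auto simp: X_def)
    moreover have "countable {b \<in> V. 0 < c a b}" if "a \<in> V" for a
      by (rule countable_subset[OF _ summable_countable_real[OF cond_summable[OF that]]]) auto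
    ultimately show "countable (X `` Y)"
      using \<open>countable Y\<close> by (auto intro: countable_UN)
  qed simp
  moreover have "V \<subseteq> X\<^sup>* `` {z}"
    using path[OF z] by (auto simp: X_def rtranclp_rtrancl_eq[symmetric])
  ultimately show ?thesis
    using countable_subset by blast
qed simp

text \<open>
  Enumerate the vertices and join each of them to \<open>x\<close> by a finite connected set; finite unions of such
  sets are connected through the common vertex \<open>x\<close>.
\<close>
lemma exhaustion_exists:
  assumes x: "x \<in> V" and y: "y \<in> V"
  obtains G where "exhaustion V c G" "\<And>k. x \<in> G k \<and> y \<in> G k"
proof -
  obtain T where T: "\<And>z. z \<in> V \<Longrightarrow> finite (T z) \<and> T z \<subseteq> V \<and> x \<in> T z \<and> z \<in> T z \<and> connected_net (T z) c"
    using finite_connecting_set[OF x] by metis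
  define e where "e = from_nat_into V"
  have e: "e i \<in> V" for i
    unfolding e_def using x by (intro from_nat_into) auto
  have e_surj: "\<exists>i. e i = z" if "z \<in> V" for z
    unfolding e_def using from_nat_into_surj[OF countable_vertices that] .
  define G where "G k = T y \<union> (\<Union>i\<le>k. T (e i))" for k
  have sub: "G k \<subseteq> V" for k
    using T y e by (fastforce simp: G_def)
  have "connected_net (G k) c" for k
  proof (rule connected_netI[OF sub])
    fix w
    assume "w \<in> G k"
    then obtain z where z: "z \<in> V" "T z \<subseteq> G k" "w \<in> T z"
      using y e unfolding G_def by blast
    then have "(\<lambda>a b. a \<in> T z \<and> b \<in> T z \<and> 0 < c a b)\<^sup>*\<^sup>* x w"
      using T unfolding connected_net_def by blast
    then show "(\<lambda>a b. a \<in> G k \<and> b \<in> G k \<and> 0 < c a b)\<^sup>*\<^sup>* x w"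
      by (rule rtranclp_mono[THEN predicate2D, rotated]) (use z in auto)
  qed
  moreover have "finite (G k)" for k
    using T y e by (auto simp: G_def)
  moreover have "incseq G"
    unfolding G_def incseq_def by fastforce
  moreover have "(\<Union>k. G k) = V"
  proof
    show "V \<subseteq> (\<Union>k. G k)"
    proof
      fix z
      assume "z \<in> V"
      then obtain i where "e i = z"
        using e_surj by blast
      then have "z \<in> G i"
        using T[OF \<open>z \<in> V\<close>] by (auto simp: G_def)
      then show "z \<in> (\<Union>k. G k)"
        by blast
    qed
  qed (use sub in blast)
  ultimately have "exhaustion V c G"
    by (simp add: exhaustion_def)
  moreover have "x \<in> G k \<and> y \<in> G k" for k
    using T[OF y] by (simp add: G_def)
  ultimately show thesis
    by (rule that)
qed

lemma exhaustionD:
  assumes "exhaustion V c G"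
  shows "finite (G k)" "G k \<subseteq> V" "network (G k) c" "k \<le> l \<Longrightarrow> G k \<subseteq> G l"
    "finite S \<Longrightarrow> S \<subseteq> V \<Longrightarrow> eventually (\<lambda>k. S \<subseteq> G k) sequentially"
proof -
  show 1: "finite (G k)" "G k \<subseteq> V" for k
    using assms by (auto simp: exhaustion_def)
  show "network (G k) c"
    using 1 assms by (intro subnetwork) (auto simp: exhaustion_def)
  show mono: "k \<le> l \<Longrightarrow> G k \<subseteq> G l" for k l
    using assms by (auto simp: exhaustion_def incseq_def)
  have "eventually (\<lambda>k. z \<in> G k) sequentially" if z: "z \<in> V" for z
  proof -
    obtain K where "z \<in> G K"
      using assms z unfolding exhaustion_def by blast
    with mono show ?thesis
      by (auto intro: eventually_sequentiallyI[of K])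
  qed
  then show "finite S \<Longrightarrow> S \<subseteq> V \<Longrightarrow> eventually (\<lambda>k. S \<subseteq> G k) sequentially"
    unfolding subset_eq by (intro eventually_ball_finite ballI) auto
qed


section \<open>Free resistance\<close>

text \<open>
  The gradients \<open>g k\<close> of the finite potentials all have the pairings of \<open>d\<close> with gradients on \<open>V\<close>,
  but they are only gradients of functions on \<open>G k\<close>; their projections to \<open>grads V c\<close> equal \<open>d\<close>.
  As \<open>k\<close> grows their norms decrease, which makes them converge, and the limit is a gradient on \<open>V\<close>.
\<close>
lemma free_limit:
  assumes G: "exhaustion V c G" and xy: "\<And>k. x \<in> G k \<and> y \<in> G k"
    and d: "d \<in> grads V c" "\<And>u. u \<in> dom_energy V c \<Longrightarrow> inner d (grad V c u) = u x - u y"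
  shows "(\<lambda>k. fin_resistance (G k) c x y) \<longlonglongrightarrow> (norm d)\<^sup>2"
proof -
  note G' = exhaustionD[OF G]
  have "\<exists>v. \<forall>z\<in>G k. laplacian (G k) c v z = indicator {x} z - indicator {y} z" for k
    by (rule network.finite_potential_exists[OF G'(3,1) conjunct1[OF xy] conjunct2[OF xy]]) blast
  then obtain v where v: "\<And>k z. z \<in> G k \<Longrightarrow> laplacian (G k) c (v k) z = indicator {x} z - indicator {y} z"
    by metis
  define g where "g k = grad (G k) c (v k)" for k
  have dom: "u \<in> dom_energy (G k) c" for u k
    using network.finite_dom_energy[OF G'(3) G'(1)] .
  have inner_g: "inner (g k) (grad (G k) c u) = u x - u y" for k u
    unfolding g_def by (rule network.finite_potential_inner[OF G'(3,1) conjunct1[OF xy] conjunct2[OF xy] v])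
  have g_V: "inner (g k) (grad V c u) = u x - u y" if "u \<in> dom_energy V c" for k u
    using inner_grad_subnetwork[OF G'(3) G'(2) dom that] inner_g by (simp add: g_def)
  have g_g: "inner (g k) (g l) = inner (g l) (g l)" if "k \<le> l" for k l
  proof -
    have "inner (g k) (g l) = inner (g k) (grad (G k) c (v l))"
      unfolding g_def by (rule network.inner_grad_subnetwork[OF G'(3) G'(3) G'(4)[OF that] dom dom])
    also have "\<dots> = v l x - v l y"
      by (rule inner_g)
    also have "\<dots> = inner (g l) (g l)"
      using inner_g[of l "v l"] by (simp add: g_def)
    finally show ?thesis .
  qed
  then have "convergent g"
    by (rule convergent_if_inner_antitone)
  then obtain l where l: "g \<longlonglongrightarrow> l"
    unfolding convergent_def by blast
  have "l \<in> grads V c"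
  proof (rule limit_of_partial_gradients[OF l])
    show "eventually (\<lambda>n. coord (g n) (a, b) = sqrt (c a b / 2) * (v n a - v n b)) sequentially"
      if "a \<in> V" "b \<in> V" for a b
      using G'(5)[of "{a, b}"] that
      by (auto elim!: eventually_mono simp: g_def network.grad_coord[OF G'(3) dom])
    show "coord (g n) p = 0" if "p \<notin> V \<times> V" for n p
      unfolding g_def using that G'(2) by (intro network.grad_outside[OF G'(3) dom]) auto
  qed
  moreover have "inner l s = inner d s" if s: "s \<in> grads V c" for s
  proof -
    obtain u where u: "u \<in> dom_energy V c" "s = grad V c u"
      using s unfolding grads_def by blast
    have "(\<lambda>k. inner (g k) s) \<longlonglongrightarrow> inner l s"
      by (intro tendsto_intros l)
    then show ?thesis
      using g_V[OF u(1)] d(2)[OF u(1)] by (simp add: u(2) LIMSEQ_const_iff)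
  qed
  ultimately have "l = d"
    using eq_if_inner_eq[OF grads_subspace] d(1) by blast
  have "fin_resistance (G k) c x y = inner (g k) (g k)" for k
    using network.fin_resistance_eq[OF G'(3,1) conjunct1[OF xy] conjunct2[OF xy] v] inner_g[of k "v k"]
    by (simp add: g_def)
  moreover have "(\<lambda>k. inner (g k) (g k)) \<longlonglongrightarrow> inner d d"
    using l unfolding \<open>l = d\<close> by (intro tendsto_intros)
  ultimately show ?thesis
    by (simp add: power2_norm_eq_inner)
qed

text \<open>
  The existence of an exhaustion is what makes the described value unique.
\<close>
lemma resistance_limit_unique:
  assumes xy: "x \<in> V" "y \<in> V"
    and lim: "\<And>G. exhaustion V c G \<Longrightarrow> (\<And>k. x \<in> G k \<and> y \<in> G k) \<Longrightarrow> R G \<longlonglongrightarrow> r"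
  shows "(THE r. \<forall>G. exhaustion V c G \<and> (\<forall>k. x \<in> G k \<and> y \<in> G k) \<longrightarrow> R G \<longlonglongrightarrow> r) = (r::real)"
proof (rule the_equality)
  obtain G where G: "exhaustion V c G" "\<And>k. x \<in> G k \<and> y \<in> G k"
    using exhaustion_exists[OF xy] by blast
  show "r' = r" if "\<forall>G. exhaustion V c G \<and> (\<forall>k. x \<in> G k \<and> y \<in> G k) \<longrightarrow> R G \<longlonglongrightarrow> r'" for r'
    using that lim[OF G] G LIMSEQ_unique by blast
qed (use lim in blast)

lemma free_resistance_eq:
  assumes "x0 \<in> V" "x \<in> V" "y \<in> V"
  shows "free_resistance V c x y = (enorm V c (ediff V c (dipole V c x0 x) (dipole V c x0 y)))\<^sup>2"
proof -
  have "free_resistance V c x y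
      = (norm (class_grad (dipole V c x0 x) - class_grad (dipole V c x0 y)))\<^sup>2"
    unfolding free_resistance_def
  proof (intro resistance_limit_unique free_limit)
    show "class_grad (dipole V c x0 x) - class_grad (dipole V c x0 y) \<in> grads V c"
      using assms by (intro subspace_diff[OF grads_subspace] class_grad_in dipole_in)
  qed (use assms in \<open>simp_all add: inner_dipole_diff\<close>)
  also have "\<dots> = (enorm V c (ediff V c (dipole V c x0 x) (dipole V c x0 y)))\<^sup>2"
    using assms by (simp add: class_dist dipole_in dist_norm)
  finally show ?thesis .
qed


section \<open>Wired resistance\<close>


lemma boundary_cond:
  assumes "x \<in> V"
  shows "(c x has_sum boundary_cond V c S x) (V - S)"
proof -
  have "boundary_cond V c S x = infsum (c x) (V - S)"
    unfolding boundary_cond_def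
    by (rule infsum_cong_neutral) (use assms cond_nonneg[of x] in \<open>auto simp: less_le\<close>)
  then show ?thesis
    using summable_on_subset_banach[OF cond_summable[OF assms], of "V - S"] by simp
qed

lemma boundary_cond_nonneg: "x \<in> V \<Longrightarrow> 0 \<le> boundary_cond V c S x"
  using has_sum_nonneg[OF boundary_cond] cond_nonneg by blast

text \<open>
  A path from \<open>S\<close> to a vertex outside must leave \<open>S\<close> along some edge; so infinity is joined to \<open>S\<close> in
  the wired network.
\<close>
lemma exit_edge:
  assumes "infinite V" "finite S" "S \<subseteq> V" "S \<noteq> {}"
  obtains s where "s \<in> S" "0 < boundary_cond V c S s"
proof -
  obtain z where z: "z \<in> V" "z \<notin> S"
    using assms(1,2) by (meson finite_subset subsetI)
  obtain s where s: "s \<in> S" "s \<in> V"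
    using assms by blast
  have "b \<in> S \<or> (\<exists>a\<in>S. \<exists>b\<in>V - S. 0 < c a b)" if "(\<lambda>a b. a \<in> V \<and> b \<in> V \<and> 0 < c a b)\<^sup>*\<^sup>* s b" for b
    using that by induction (use s in auto)
  from this[OF path[OF s(2) z(1)]] z obtain a b where ab: "a \<in> S" "b \<in> V - S" "0 < c a b"
    by blast
  have "a \<in> V"
    using ab assms(3) by blast
  have "sum (c a) {b} \<le> boundary_cond V c S a"
    by (rule finite_sum_le_has_sum[OF boundary_cond[OF \<open>a \<in> V\<close>]])
      (use ab cond_nonneg[OF \<open>a \<in> V\<close>] in auto)
  with ab(3) have "0 < boundary_cond V c S a"
    by simp
  with ab(1) show thesis
    by (rule that)
qed

lemma wired_network:
  assumes V: "infinite V" and S: "finite S" "S \<subseteq> V" "connected_net S c" "S \<noteq> {}"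
  shows "network (wired_vertices S) (wired_cond V c S)"
proof -
  let ?W = "wired_vertices S" and ?C = "wired_cond V c S"
  let ?R = "\<lambda>a b. a \<in> ?W \<and> b \<in> ?W \<and> 0 < ?C a b"
  have SV: "x \<in> V" if "x \<in> S" for x
    using that S by blast
  have sym: "?C a b = ?C b a" if "a \<in> ?W" "b \<in> ?W" for a b
    using that SV by (auto simp: wired_vertices_def cond_commute)
  have lift: "?R\<^sup>*\<^sup>* (Some a) (Some b)" if "(\<lambda>a b. a \<in> S \<and> b \<in> S \<and> 0 < c a b)\<^sup>*\<^sup>* a b" for a b
    using that
  proof induction
    case (step b d)
    then have "?R (Some b) (Some d)"
      by (auto simp: wired_vertices_def)
    with step.IH show ?case
      by (rule rtranclp.rtrancl_into_rtrancl)
  qed simp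
  obtain s where s: "s \<in> S" "0 < boundary_cond V c S s"
    using exit_edge[OF V S(1,2,4)] by blast
  have from_s: "?R\<^sup>*\<^sup>* (Some s) a" if a: "a \<in> ?W" for a
  proof (cases a)
    case None
    then show ?thesis
      using s by (intro r_into_rtranclp) (auto simp: wired_vertices_def)
  next
    case (Some z)
    then show ?thesis
      using a s S(3) lift unfolding connected_net_def by (auto simp: wired_vertices_def)
  qed
  have "symp ?R"
    using sym by (auto intro!: sympI)
  then have "?R\<^sup>*\<^sup>* a b" if "a \<in> ?W" "b \<in> ?W" for a b
    using from_s[OF that(1)] from_s[OF that(2)] by (meson rtranclp_trans sympD symp_rtranclp)
  then have "connected_net ?W ?C"
    by (simp add: connected_net_def)
  moreover have "0 \<le> ?C a b" if "a \<in> ?W" "b \<in> ?W" for a b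
    using that SV by (auto simp: wired_vertices_def cond_nonneg boundary_cond_nonneg)
  moreover have "?C a a = 0" if "a \<in> ?W" for a
    using that SV by (auto simp: wired_vertices_def cond_refl)
  moreover have "finite ?W"
    using S(1) by (simp add: wired_vertices_def)
  ultimately show ?thesis
    using sym by unfold_locales (auto simp: resistance_network_def)
qed

text \<open>
  Outside \<open>S\<close> the extension \<open>w\<close> is zero, which is also the potential at infinity, so the edges leaving
  \<open>S\<close> at \<open>z\<close> contribute in the same way as the single edge of total conductance to infinity.
\<close>
lemma laplacian_wired:
  assumes W: "network (wired_vertices S) (wired_cond V c S)" and S: "finite S" "S \<subseteq> V"
    and v: "v None = 0" and z: "z \<in> S"
  defines "w \<equiv> \<lambda>x. if x \<in> S then v (Some x) else 0"
  shows "laplacian V c w z = laplacian (wired_vertices S) (wired_cond V c S) v (Some z)"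
proof -
  interpret W: network "wired_vertices S" "wired_cond V c S"
    by (rule W)
  have zV: "z \<in> V"
    using z S by blast
  let ?s = "(\<Sum>y\<in>S. c z y * (v (Some z) - v (Some y)))" and ?b = "boundary_cond V c S z * v (Some z)"
  have "((\<lambda>y. wired_cond V c S (Some z) y * (v (Some z) - v y)) has_sum (?b + ?s)) (wired_vertices S)"
  proof (rule has_sum_finiteI)
    show "finite (wired_vertices S)"
      using S by (simp add: wired_vertices_def)
    show "?b + ?s = (\<Sum>y\<in>wired_vertices S. wired_cond V c S (Some z) y * (v (Some z) - v y))"
      using S(1) by (simp add: wired_vertices_def v sum.reindex)
  qed
  then have "laplacian (wired_vertices S) (wired_cond V c S) v (Some z) = ?b + ?s"
    using z by (subst (asm) W.laplacian_has_sum_iff) (auto simp: wired_vertices_def)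
  moreover have "((\<lambda>y. c z y * (w z - w y)) has_sum (?b + ?s)) ((V - S) \<union> S)"
  proof (rule has_sum_Un_disjoint)
    have "((\<lambda>y. c z y * v (Some z)) has_sum ?b) (V - S)"
      by (rule has_sum_cmult_left[OF boundary_cond[OF zV]])
    then show "((\<lambda>y. c z y * (w z - w y)) has_sum ?b) (V - S)"
      by (rule has_sum_cong[THEN iffD1, rotated]) (use z in \<open>simp add: w_def\<close>)
    show "((\<lambda>y. c z y * (w z - w y)) has_sum ?s) S"
      by (rule has_sum_finiteI[OF S(1)], rule sum.cong) (use z in \<open>simp_all add: w_def\<close>)
  qed auto
  then have "laplacian V c w z = ?b + ?s"
    using S(2) laplacian_has_sum_iff[OF zV, of w] by (simp add: Un_absorb2)
  ultimately show ?thesis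
    by simp
qed

lemma wired_potential:
  assumes V: "infinite V" and S: "finite S" "S \<subseteq> V" "connected_net S c" and xy: "x \<in> S" "y \<in> S"
  obtains w where "\<And>z. z \<notin> S \<Longrightarrow> w z = 0"
    "\<And>z. z \<in> S \<Longrightarrow> laplacian V c w z = indicator {x} z - indicator {y} z"
    "fin_resistance (wired_vertices S) (wired_cond V c S) (Some x) (Some y) = w x - w y"
proof -
  have net: "network (wired_vertices S) (wired_cond V c S)"
    using wired_network[OF V S] xy by blast
  interpret W: network "wired_vertices S" "wired_cond V c S"
    by (rule net)
  have W: "finite (wired_vertices S)" "Some x \<in> wired_vertices S" "Some y \<in> wired_vertices S"
    using S xy by (auto simp: wired_vertices_def)
  obtain v' where v': "\<And>z. z \<in> wired_vertices S \<Longrightarrow> laplacian (wired_vertices S) (wired_cond V c S) v' z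
      = indicator {Some x} z - indicator {Some y} z"
    using W.finite_potential_exists[OF W] by blast
  \<comment> \<open>ground the potential at infinity\<close>
  define v where "v z = v' z - v' None" for z
  have v: "laplacian (wired_vertices S) (wired_cond V c S) v z = indicator {Some x} z - indicator {Some y} z"
    if "z \<in> wired_vertices S" for z
    using v'[OF that] by (simp add: v_def laplacian_def)
  define w where "w z = (if z \<in> S then v (Some z) else 0)" for z
  show thesis
  proof
    show "w z = 0" if "z \<notin> S" for z
      using that by (simp add: w_def)
    show "laplacian V c w z = indicator {x} z - indicator {y} z" if "z \<in> S" for z
    proof -
      have "laplacian V c w z = laplacian (wired_vertices S) (wired_cond V c S) v (Some z)"
        unfolding w_def by (rule laplacian_wired[OF net S(1,2) _ that]) (simp add: v_def)
      with v[of "Some z"] that show ?thesis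
        by (simp add: wired_vertices_def indicator_def)
    qed
    show "fin_resistance (wired_vertices S) (wired_cond V c S) (Some x) (Some y) = w x - w y"
      using W.fin_resistance_eq[OF W v] xy by (simp add: w_def)
  qed
qed

text \<open>
  The gradients \<open>g k\<close> of the grounded potentials lie in the span of the \<open>\<delta>\<^sub>z\<close> with \<open>z \<in> G k\<close>, and have the
  pairings of \<open>d\<close> with these \<open>\<delta>\<^sub>z\<close>.
\<close>
lemma wired_limit:
  assumes V: "infinite V" and G: "exhaustion V c G" and xy: "\<And>k. x \<in> G k \<and> y \<in> G k"
    and d: "\<And>u. u \<in> dom_energy V c \<Longrightarrow> inner d (grad V c u) = u x - u y"
  shows "(\<lambda>k. fin_resistance (wired_vertices (G k)) (wired_cond V c (G k)) (Some x) (Some y))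
    \<longlonglongrightarrow> (norm (orth_proj fins d))\<^sup>2"
proof -
  note G' = exhaustionD[OF G]
  let ?R = "\<lambda>k. fin_resistance (wired_vertices (G k)) (wired_cond V c (G k)) (Some x) (Some y)"
  let ?p = "orth_proj fins d"
  have "\<exists>w. (\<forall>z. z \<notin> G k \<longrightarrow> w z = 0) \<and>
      (\<forall>z\<in>G k. laplacian V c w z = indicator {x} z - indicator {y} z) \<and> ?R k = w x - w y" for k
  proof -
    have "connected_net (G k) c"
      using G by (simp add: exhaustion_def)
    from wired_potential[OF V G'(1,2) this conjunct1[OF xy] conjunct2[OF xy]] show ?thesis
      by metis
  qed
  then obtain w where w0: "\<And>k z. z \<notin> G k \<Longrightarrow> w k z = 0"
    and lap: "\<And>k z. z \<in> G k \<Longrightarrow> laplacian V c (w k) z = indicator {x} z - indicator {y} z"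
    and R: "\<And>k. ?R k = w k x - w k y"
    by metis
  define g where "g k = grad V c (w k)" for k
  have dom: "w k \<in> dom_energy V c" for k
    by (rule inner_grad_finite_support(1)[OF dom_energy_zero G'(1)[of k] G'(2)]) (use w0 in blast)
  have g_eq: "g k = (\<Sum>z\<in>G k. w k z *\<^sub>R delta z)" for k
    unfolding g_def delta_def
    by (rule inner_grad_finite_support(2)[OF dom_energy_zero G'(1,2)]) (use w0 in blast)
  have R_eq: "?R k = inner (g k) (g k)" for k
  proof -
    have "inner (g k) (g k) = (\<Sum>z\<in>G k. w k z * laplacian V c (w k) z)"
      unfolding g_def by (rule inner_grad_finite_support(3)[OF dom G'(1,2)]) (use w0 in blast)
    also have "\<dots> = (\<Sum>z\<in>G k. (if z = x then w k z else 0) - (if z = y then w k z else 0))"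
      by (rule sum.cong) (auto simp: lap indicator_def)
    also have "\<dots> = w k x - w k y"
      using G'(1) xy by (simp add: sum_subtractf)
    finally show ?thesis
      by (simp add: R)
  qed
  define F where "F k = span (delta ` G k)" for k
  have "g \<longlonglongrightarrow> ?p"
  proof (rule projections_tendsto)
    show "subspace (F k)" for k
      by (simp add: F_def)
    show "incseq F"
      unfolding F_def incseq_def using G'(4) by (simp add: image_mono span_mono)
    show "g k \<in> F k" for k
      unfolding g_eq F_def by (auto intro!: span_sum span_scale intro: span_base)
    have "\<exists>k. S \<subseteq> G k" if "finite S" "S \<subseteq> V" for S
      using G'(5)[OF that] by (auto simp: eventually_sequentially)
    then have "fins \<subseteq> closure (\<Union>k. F k)"
      unfolding fins_def F_def by (intro closure_mono span_image_UN)
    then show "?p \<in> closure (\<Union>k. F k)"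
      using orth_proj_in[OF fins] by blast
    have "F k \<subseteq> {s. inner (g k) s = inner ?p s}" for k
      unfolding F_def
    proof (rule span_minimal)
      show "subspace {s. inner (g k) s = inner ?p s}"
        by (simp add: subspace_def inner_add_right)
      show "delta ` G k \<subseteq> {s. inner (g k) s = inner ?p s}"
      proof clarify
        fix z
        assume z: "z \<in> G k"
        then have zV: "z \<in> V"
          using G'(2) by blast
        have "delta z \<in> fins"
          unfolding fins_def using zV by (intro closure_subset[THEN subsetD] span_base imageI)
        then have "inner ?p (delta z) = indicator {z} x - indicator {z} y"
          using d[OF delta_dom_energy[OF zV]] by (simp add: orth_proj_inner[OF fins] delta_def)
        moreover have "inner (g k) (delta z) = indicator {x} z - indicator {y} z"
          using inner_grad_delta[OF dom zV] lap[OF z] by (simp add: g_def delta_def)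
        ultimately show "inner (g k) (delta z) = inner ?p (delta z)"
          by (auto simp: indicator_def)
      qed
    qed
    then show "inner (g k) s = inner ?p s" if "s \<in> F k" for k s
      using that by blast
  qed
  then have "(\<lambda>k. inner (g k) (g k)) \<longlonglongrightarrow> inner ?p ?p"
    by (intro tendsto_intros)
  then show ?thesis
    by (simp add: R_eq power2_norm_eq_inner)
qed

lemma fin_dipole:
  assumes "x0 \<in> V" "x \<in> V"
  shows fin_dipole_in: "fin_dipole V c x0 x \<in> Fin V c"
    and class_grad_fin_dipole: "class_grad (fin_dipole V c x0 x) = orth_proj fins (class_grad (dipole V c x0 x))"
  using assms by (simp_all add: fin_dipole_def proj_Fin dipole_in)

lemma wired_resistance_eq:
  assumes V: "infinite V" and x: "x0 \<in> V" "x \<in> V" "y \<in> V"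
  shows "wired_resistance V c x y = (enorm V c (ediff V c (fin_dipole V c x0 x) (fin_dipole V c x0 y)))\<^sup>2"
proof -
  let ?g = "\<lambda>x. class_grad (dipole V c x0 x)"
  have "orth_proj fins (?g x - ?g y) = orth_proj fins (?g x) - orth_proj fins (?g y)"
    by (rule eq_if_inner_eq[OF fins(1)])
      (auto intro!: orth_proj_in[OF fins] subspace_diff[OF fins(1)] simp: orth_proj_inner[OF fins] inner_diff_left)
  moreover have "wired_resistance V c x y = (norm (orth_proj fins (?g x - ?g y)))\<^sup>2"
    unfolding wired_resistance_def
    by (intro resistance_limit_unique wired_limit) (use x V in \<open>simp_all add: inner_dipole_diff\<close>)
  moreover have "fin_dipole V c x0 z \<in> energy_space V c" if "z \<in> V" for z
    using fin_dipole_in[OF x(1) that] mem_Fin_iff by blast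
  ultimately show ?thesis
    using x by (simp add: class_dist dist_norm class_grad_fin_dipole)
qed

lemma closure_span_dipoles:
  assumes "x0 \<in> V"
  shows "closure (span ((\<lambda>x. class_grad (dipole V c x0 x)) ` V)) = grads V c"
proof (rule closure_span_eq_if_total[OF grads_subspace grads_closed])
  show "w = 0" if w: "w \<in> grads V c"
    and orth: "\<And>t. t \<in> (\<lambda>x. class_grad (dipole V c x0 x)) ` V \<Longrightarrow> inner w t = 0" for w
    by (rule dipoles_total[OF assms w]) (use orth in blast)
qed (use assms in \<open>auto intro: class_grad_in dipole_in\<close>)

lemma closure_span_fin_dipoles:
  assumes "x0 \<in> V"
  shows "closure (span ((\<lambda>x. class_grad (fin_dipole V c x0 x)) ` V)) = fins"
proof (rule closure_span_eq_if_total[OF fins])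
  show "w = 0" if w: "w \<in> fins"
    and orth: "\<And>t. t \<in> (\<lambda>x. class_grad (fin_dipole V c x0 x)) ` V \<Longrightarrow> inner w t = 0" for w
  proof (rule dipoles_total[OF assms])
    show "w \<in> grads V c"
      using w fins_subset by blast
    show "inner w (class_grad (dipole V c x0 x)) = 0" if "x \<in> V" for x
      using orth[of "class_grad (fin_dipole V c x0 x)"] orth_proj_inner[OF fins w] that assms
      by (simp add: class_grad_fin_dipole inner_commute)
  qed
qed (use assms class_grad_Fin fin_dipole_in in blast)

end


theorem corollary5p6:
  fixes V :: "'v set" and c :: "'v \<Rightarrow> 'v \<Rightarrow> real" and x0 :: 'v
  assumes "resistance_network V c" and "infinite V" and "x0 \<in> V"
  shows
    "((\<forall>x\<in>V. dipole V c x0 x \<in> energy_space V c) \<and>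
      (\<forall>x\<in>V. \<forall>y\<in>V. free_resistance V c x y =
         (enorm V c (ediff V c (dipole V c x0 x) (dipole V c x0 y)))\<^sup>2) \<and>
      (\<forall>k :: 'v \<Rightarrow> 'k :: {real_inner, complete_space}.
         (\<forall>x\<in>V. \<forall>y\<in>V. (norm (k x - k y))\<^sup>2 = free_resistance V c x y) \<and>
         closure (span ((\<lambda>x. k x - k x0) ` V)) = UNIV \<longrightarrow>
         (\<exists>U. unitary_iso V c (energy_space V c) U \<and>
              (\<forall>x\<in>V. U (k x - k x0) = dipole V c x0 x))))
     \<and>
     ((\<forall>x\<in>V. fin_dipole V c x0 x \<in> Fin V c) \<and>
      (\<forall>x\<in>V. \<forall>y\<in>V. wired_resistance V c x y =
         (enorm V c (ediff V c (fin_dipole V c x0 x) (fin_dipole V c x0 y)))\<^sup>2) \<and>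
      (\<forall>k :: 'v \<Rightarrow> 'k.
         (\<forall>x\<in>V. \<forall>y\<in>V. (norm (k x - k y))\<^sup>2 = wired_resistance V c x y) \<and>
         closure (span ((\<lambda>x. k x - k x0) ` V)) = UNIV \<longrightarrow>
         (\<exists>U. unitary_iso V c (Fin V c) U \<and>
              (\<forall>x\<in>V. U (k x - k x0) = fin_dipole V c x0 x))))"
proof -
  interpret network V c
    by (rule network.intro) (rule assms(1))
  note x0 = \<open>x0 \<in> V\<close>
  have free: "free_resistance V c x y = (enorm V c (ediff V c (dipole V c x0 x) (dipole V c x0 y)))\<^sup>2"
    if "x \<in> V" "y \<in> V" for x y
    using free_resistance_eq[OF x0 that] .
  have wired: "wired_resistance V c x y = (enorm V c (ediff V c (fin_dipole V c x0 x) (fin_dipole V c x0 y)))\<^sup>2"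
    if "x \<in> V" "y \<in> V" for x y
    using wired_resistance_eq[OF assms(2) x0 that] .
  have "\<exists>U. unitary_iso V c (energy_space V c) U \<and> (\<forall>x\<in>V. U (k x - k x0) = dipole V c x0 x)"
    if k: "\<forall>x\<in>V. \<forall>y\<in>V. (norm (k x - k y))\<^sup>2 = free_resistance V c x y"
      and dense: "closure (span ((\<lambda>x. k x - k x0) ` V)) = UNIV" for k :: "'v \<Rightarrow> 'k"
  proof (rule unitary_extension[OF x0 order_refl _ _ _ _ dense])
    show "closure (span ((\<lambda>x. class_grad (dipole V c x0 x)) ` V)) = class_grad ` energy_space V c"
      using closure_span_dipoles[OF x0] bij_class_grad by (simp add: bij_betw_def)
  qed (use k x0 in \<open>simp_all add: dipole_in dipole_base free\<close>)
  moreover have "\<exists>U. unitary_iso V c (Fin V c) U \<and> (\<forall>x\<in>V. U (k x - k x0) = fin_dipole V c x0 x)"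
    if k: "\<forall>x\<in>V. \<forall>y\<in>V. (norm (k x - k y))\<^sup>2 = wired_resistance V c x y"
      and dense: "closure (span ((\<lambda>x. k x - k x0) ` V)) = UNIV" for k :: "'v \<Rightarrow> 'k"
  proof (rule unitary_extension[OF x0 _ _ _ _ _ dense])
    show "closure (span ((\<lambda>x. class_grad (fin_dipole V c x0 x)) ` V)) = class_grad ` Fin V c"
      using closure_span_fin_dipoles[OF x0] class_grad_Fin by simp
    have "orth_proj fins 0 = 0"
      using orth_proj_inner[OF fins orth_proj_in[OF fins, of 0], of 0] by simp
    then show "class_grad (fin_dipole V c x0 x0) = 0"
      using x0 by (simp add: class_grad_fin_dipole dipole_base)
    show "Fin V c \<subseteq> energy_space V c"
      using mem_Fin_iff by blast
  qed (use k x0 in \<open>simp_all add: fin_dipole_in wired\<close>)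
  ultimately show ?thesis
    using free wired x0 by (auto simp: dipole_in fin_dipole_in)
qed

end
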